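(* Let $2\le r<\infty$, $2^{r-1}\le n\le2^r-1$, $1\le j\le n$, and let $f$ be an original on the domain $U_{1,\dots,1}=\{t\in\mathbf R^n:t_k\ge0\ \forall k\}$ such that $\partial f(t)/\partial t_k$ for $k=j-1$ and $k=j$ also satisfies the conditions (1)–(4) in the definition of an original. Then, in the domain $W=\{p\in\mathcal A_r:\max(a_1(f),a_1(\partial f/\partial t_j))<\mathrm{Re}(p)\}$: (1) for the spherical kernel (S), $$\mathcal F^n\big((\partial f/\partial t_j)\chi_{U_{1,\dots,1}},u;p;\zeta\big)=-\mathcal F^{n-1;t^j}\big(f\chi_{U_{1,\dots,1}}(t^j),u(p,t^j;\zeta);p;\zeta\big)+\Big[p_0+\sum_{k=1}^jp_k\mathsf S_{e_k}\Big]\mathcal F^n\big(f\chi_{U_{1,\dots,1}},u;p;\zeta\big);$$ (1.1) for the Cartesian kernel (C), $$\mathcal F^n\big((\partial f/\partial t_j)\chi_{U_{1,\dots,1}},u;p;\zeta\big)=-\mathcal F^{n-1;t^j}\big(f\chi_{U_{1,\dots,1}}(t^j),u(p,t^j;\zeta);p;\zeta\big)+[p_0+p_j\mathsf S_{e_j}]\,\mathcal F^n\big(f\chi_{U_{1,\dots,1}},u;p;\zeta\big).$$ Here $t^j=(t_1,\dots,t_{j-1},0,t_{j+1},\dots,t_n)$ and $\mathsf S_{e_k}=-\partial/\partial\zeta_k$ for $k\ge1$.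
   Context: Cayley–Dickson algebras: $\mathcal A_0=\mathbf R$ and $\mathcal A_{r+1}=\mathcal A_r\oplus\mathcal A_r\mathbf l$ with $(\xi+\eta\mathbf l)(\gamma+\delta\mathbf l)=(\xi\gamma-\delta^*\eta)+(\delta\xi+\eta\gamma^* )\mathbf l$, $(\xi+\eta\mathbf l)^*=\xi^*-\eta\mathbf l$. The standard basis of $\mathcal A_r$ is $i_0=1,i_1,\dots,i_{2^r-1}$, with $i_j^2=-1$, $i_ji_k=-i_ki_j$ for $j\ne k$, $j,k\ge1$. $\mathrm{Re}(z)=(z+z^* )/2$, $|z|^2=zz^*$, $\exp(z)=\sum_kz^k/k!$. Write $p=\sum_jp_ji_j$, $\zeta=\sum_j\zeta_ji_j$ with real $p_j,\zeta_j$. When $n<2^r-1$ one puts $p_m=\zeta_m=t_m=0$ for $m>n$. $\chi_U$ is the characteristic function of $U$. Originals: $f:\mathbf R^n\to\mathcal A_r$ is an original if (1) $f$ is continuous almost everywhere for the Lebesgue measure; (2) each partial function $t_j\mapsto f(t)$ has on each finite interval only finitely many discontinuities, all of the first kind; (3) each partial function $g_j(t_j)=f(t)$ satisfies, except possibly at its discontinuities of the first kind, a Hölder condition $|g_j(t_j+h)-g_j(t_j)|\le A_j|h|^{\alpha_j}$ for $|h|<\delta_j$, with constants $0<\alpha_j\le1$, $A_j,\delta_j>0$ (for the given $t$); (4) there are real $a_1(f),a_{-1}(f)$ and constants $C_v>0$ such that for each $v\in\{-1,1\}^n$, $|f(t)|<C_v\exp(\sum_ja_{v_j}t_j)$ whenever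 $v_jt_j\ge0$ for all $j$. For an original on $U_{1,\dots,1}$ (supported there) only $a_1(f)$ matters, i.e. $a_{-1}=\infty$. Kernels: (C) Cartesian: $u(p,t;\zeta)=p_0(t_1+\dots+t_n)+\sum_{j=1}^np_jt_ji_j+\zeta$. (S) Spherical: with $s_j=t_j+\dots+t_n$, $K=2^r-1$, $\phi_j=p_js_j+\zeta_j$: $u=p_0s_1+M+\zeta_0$, $M=\phi_1[i_1\cos\phi_2+i_2\sin\phi_2\cos\phi_3+\dots+i_{K-1}\sin\phi_2\cdots\sin\phi_{K-1}\cos\phi_K+i_K\sin\phi_2\cdots\sin\phi_K]$. Transforms: $\mathcal F^n(h,u;p;\zeta)=\int_{\mathbf R^n}h(t)\exp(-u(p,t;\zeta))\,dt$ and $\mathcal F^{n-1;t^j}(f\chi_{U_{1,\dots,1}}(t^j),u(p,t^j;\zeta);p;\zeta)=\int_0^\infty\!\!\cdots\int_0^\infty f(t^j)\exp(-u(p,t^j;\zeta))\,dt_1\cdots dt_{j-1}dt_{j+1}\cdots dt_n$. *)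

theory Defs
  imports "HOL-Analysis.Analysis"
begin

text \<open>
  An element of the \<open>r\<close>-th algebra is its coordinate sequence with respect to the standard basis:
  coordinates \<open>i < 2 ^ r\<close>, and zero beyond. An element of level \<open>r + 1\<close> is
  \<open>\<xi> + \<eta> l\<close>, where \<open>\<xi>\<close> (\<open>cd_fst\<close>) is the lower and \<open>\<eta>\<close> (\<open>cd_snd\<close>) the upper half of the
  coordinates; thus the basis element of index \<open>2 ^ r + m\<close> is \<open>i\<^sub>m l\<close>. Limits, derivatives, series
  and integrals of values in this finite-dimensional space are taken coordinatewise; the
  topology on \<^typ>\<open>nat \<Rightarrow> real\<close> is the product topology, which induces the norm topology on each
  algebra.
\<close>

type_synonym cd = "nat \<Rightarrow> real"

definition cd_carrier :: "nat \<Rightarrow> cd set" where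
  "cd_carrier r = {z. \<forall>i\<ge>2 ^ r. z i = 0}"

definition cd_zero :: cd where
  "cd_zero = (\<lambda>i. 0)"

definition cd_basis :: "nat \<Rightarrow> cd" where
  "cd_basis m = (\<lambda>i. if i = m then 1 else 0)"

definition cd_fst :: "nat \<Rightarrow> cd \<Rightarrow> cd" where
  "cd_fst r z = (\<lambda>i. if i < 2 ^ r then z i else 0)"

definition cd_snd :: "nat \<Rightarrow> cd \<Rightarrow> cd" where
  "cd_snd r z = (\<lambda>i. if i < 2 ^ r then z (2 ^ r + i) else 0)"

definition cd_pair :: "nat \<Rightarrow> cd \<Rightarrow> cd \<Rightarrow> cd" where
  "cd_pair r \<xi> \<eta> =
     (\<lambda>i. if i < 2 ^ r then \<xi> i else if i < 2 ^ Suc r then \<eta> (i - 2 ^ r) else 0)"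

primrec cd_conj :: "nat \<Rightarrow> cd \<Rightarrow> cd" where
  "cd_conj 0 z = z"
| "cd_conj (Suc r) z = cd_pair r (cd_conj r (cd_fst r z)) (\<lambda>i. - cd_snd r z i)"

primrec cd_mult :: "nat \<Rightarrow> cd \<Rightarrow> cd \<Rightarrow> cd" where
  "cd_mult 0 x y = (\<lambda>i. if i = 0 then x 0 * y 0 else 0)"
| "cd_mult (Suc r) x y =
     (let \<xi> = cd_fst r x; \<eta> = cd_snd r x; \<gamma> = cd_fst r y; \<delta> = cd_snd r y in
      cd_pair r
        (\<lambda>i. cd_mult r \<xi> \<gamma> i - cd_mult r (cd_conj r \<delta>) \<eta> i)
        (\<lambda>i. cd_mult r \<delta> \<xi> i + cd_mult r \<eta> (cd_conj r \<gamma>) i))"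

definition cd_Re :: "nat \<Rightarrow> cd \<Rightarrow> real" where
  "cd_Re r z = (z 0 + cd_conj r z 0) / 2"

definition cd_norm :: "nat \<Rightarrow> cd \<Rightarrow> real" where
  "cd_norm r z = sqrt (cd_mult r z (cd_conj r z) 0)"

text \<open>The algebras are power-associative, so the bracketing of the powers is immaterial.\<close>

primrec cd_power :: "nat \<Rightarrow> cd \<Rightarrow> nat \<Rightarrow> cd" where
  "cd_power r z 0 = cd_basis 0"
| "cd_power r z (Suc k) = cd_mult r z (cd_power r z k)"

definition cd_exp :: "nat \<Rightarrow> cd \<Rightarrow> cd" where
  "cd_exp r z = (\<lambda>i. \<Sum>k. cd_power r z k i / fact k)"

text \<open>
  The space \<open>\<real>\<^sup>n\<close> consists of the extensional functions on \<open>{1..n}\<close>, the space of the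
  product measure. That measure is completed because an almost everywhere continuous function
  is Lebesgue, but in general not Borel, measurable.
\<close>

definition Rn :: "nat \<Rightarrow> (nat \<Rightarrow> real) set" where
  "Rn n = PiE {1..n} (\<lambda>_. UNIV)"

definition orthant :: "nat \<Rightarrow> (nat \<Rightarrow> real) set" where
  "orthant n = {t \<in> Rn n. \<forall>k\<in>{1..n}. 0 \<le> t k}"

definition lebesgue_on_coords :: "nat set \<Rightarrow> (nat \<Rightarrow> real) measure" where
  "lebesgue_on_coords I = completion (PiM I (\<lambda>_. lborel))"

definition first_kind_discontinuity :: "(real \<Rightarrow> cd) \<Rightarrow> real \<Rightarrow> bool" where
  "first_kind_discontinuity g x \<longleftrightarrow>
     \<not> isCont g x \<and> (\<exists>l. (g \<longlongrightarrow> l) (at_left x)) \<and> (\<exists>l. (g \<longlongrightarrow> l) (at_right x))"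

definition original :: "nat \<Rightarrow> nat \<Rightarrow> ((nat \<Rightarrow> real) \<Rightarrow> cd) \<Rightarrow> real \<Rightarrow> real \<Rightarrow> bool" where
  "original r n f a1 am1 \<longleftrightarrow>
     (\<forall>t\<in>Rn n. f t \<in> cd_carrier r) \<and>
     (AE t in lebesgue_on_coords {1..n}. continuous (at t within Rn n) f) \<and>
     (\<forall>t\<in>Rn n. \<forall>k\<in>{1..n}. let g = (\<lambda>x. f (t(k := x))) in
        (\<forall>c d. finite {x \<in> {c..d}. \<not> isCont g x}) \<and>
        (\<forall>x. \<not> isCont g x \<longrightarrow> first_kind_discontinuity g x)) \<and>
     (\<forall>t\<in>Rn n. \<forall>k\<in>{1..n}. let g = (\<lambda>x. f (t(k := x))) in
        \<not> first_kind_discontinuity g (t k) \<longrightarrow>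
        (\<exists>A \<alpha> \<delta>. 0 < A \<and> 0 < \<alpha> \<and> \<alpha> \<le> 1 \<and> 0 < \<delta> \<and>
           (\<forall>h. \<bar>h\<bar> < \<delta> \<longrightarrow>
              cd_norm r (\<lambda>i. g (t k + h) i - g (t k) i) \<le> A * \<bar>h\<bar> powr \<alpha>))) \<and>
     (\<forall>v \<in> {1..n} \<rightarrow> {-1, 1::real}. \<exists>C>0. \<forall>t\<in>Rn n.
        (\<forall>k\<in>{1..n}. 0 \<le> v k * t k) \<longrightarrow>
        cd_norm r (f t) < C * exp (\<Sum>k\<in>{1..n}. (if v k = 1 then a1 else am1) * t k))"

definition cut_off :: "(nat \<Rightarrow> real) set \<Rightarrow> ((nat \<Rightarrow> real) \<Rightarrow> cd) \<Rightarrow> (nat \<Rightarrow> real) \<Rightarrow> cd" where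
  "cut_off U f = (\<lambda>t. if t \<in> U then f t else cd_zero)"

text \<open>
  An original on the orthant, with growth exponent \<open>a\<close> there. Since the function is cut off
  outside the orthant, one value of the second exponent is admissible iff every value is.
\<close>

definition original_on_orthant :: "nat \<Rightarrow> nat \<Rightarrow> ((nat \<Rightarrow> real) \<Rightarrow> cd) \<Rightarrow> real \<Rightarrow> bool" where
  "original_on_orthant r n f a \<longleftrightarrow> (\<exists>am1. original r n (cut_off (orthant n) f) a am1)"

text \<open>Partial derivatives on the orthant are one-sided at boundary points.\<close>

definition partial_differentiable_on_orthant ::
    "nat \<Rightarrow> ((nat \<Rightarrow> real) \<Rightarrow> cd) \<Rightarrow> nat \<Rightarrow> bool" where
  "partial_differentiable_on_orthant n f k \<longleftrightarrow>
     (\<forall>t\<in>orthant n. \<forall>i. (\<lambda>x. f (t(k := x)) i) differentiable (at (t k) within {0..}))"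

definition partial_deriv :: "((nat \<Rightarrow> real) \<Rightarrow> cd) \<Rightarrow> nat \<Rightarrow> (nat \<Rightarrow> real) \<Rightarrow> cd" where
  "partial_deriv f k = (\<lambda>t i. vector_derivative (\<lambda>x. f (t(k := x)) i) (at (t k) within {0..}))"

type_synonym kernel = "cd \<Rightarrow> (nat \<Rightarrow> real) \<Rightarrow> cd \<Rightarrow> cd"

definition cartesian_kernel :: "nat \<Rightarrow> kernel" where
  "cartesian_kernel n p t \<zeta> =
     (\<lambda>i. p 0 * (\<Sum>k=1..n. t k) * cd_basis 0 i + (\<Sum>k=1..n. p k * t k * cd_basis k i) + \<zeta> i)"

definition tail_sum :: "nat \<Rightarrow> (nat \<Rightarrow> real) \<Rightarrow> nat \<Rightarrow> real" where
  "tail_sum n t k = (\<Sum>m=k..n. t m)"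

text \<open>For \<open>k > n\<close> the tail sum is empty, which is the convention \<open>t\<^sub>m = 0\<close> for \<open>m > n\<close>.\<close>

definition spherical_kernel :: "nat \<Rightarrow> nat \<Rightarrow> kernel" where
  "spherical_kernel r n p t \<zeta> =
     (let K = 2 ^ r - 1; \<phi> = (\<lambda>k. p k * tail_sum n t k + \<zeta> k) in
      (\<lambda>i. (p 0 * tail_sum n t 1 + \<zeta> 0) * cd_basis 0 i
         + \<phi> 1 * ((\<Sum>m=1..K-1. (\<Prod>l=2..m. sin (\<phi> l)) * cos (\<phi> (m + 1)) * cd_basis m i)
                  + (\<Prod>l=2..K. sin (\<phi> l)) * cd_basis K i)))"

definition integrand ::
    "nat \<Rightarrow> ((nat \<Rightarrow> real) \<Rightarrow> cd) \<Rightarrow> kernel \<Rightarrow> cd \<Rightarrow> cd \<Rightarrow> (nat \<Rightarrow> real) \<Rightarrow> cd" where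
  "integrand r h u p \<zeta> t = cd_mult r (h t) (cd_exp r (\<lambda>i. - u p t \<zeta> i))"

definition transform ::
    "nat \<Rightarrow> nat \<Rightarrow> ((nat \<Rightarrow> real) \<Rightarrow> cd) \<Rightarrow> kernel \<Rightarrow> cd \<Rightarrow> cd \<Rightarrow> cd" where
  "transform r n h u p \<zeta> =
     (\<lambda>i. LINT t|lebesgue_on_coords {1..n}. integrand r h u p \<zeta> t i)"

definition transform_exists ::
    "nat \<Rightarrow> nat \<Rightarrow> ((nat \<Rightarrow> real) \<Rightarrow> cd) \<Rightarrow> kernel \<Rightarrow> cd \<Rightarrow> cd \<Rightarrow> bool" where
  "transform_exists r n h u p \<zeta> \<longleftrightarrow>
     (\<forall>i. integrable (lebesgue_on_coords {1..n}) (\<lambda>t. integrand r h u p \<zeta> t i))"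

text \<open>
  The transform over the hyperplane \<open>t\<^sub>j = 0\<close>. Applied to \<open>cut_off (orthant n) f\<close> it integrates over
  \<open>t\<^sub>k \<ge> 0\<close>, \<open>k \<noteq> j\<close>.
\<close>

definition face_transform ::
    "nat \<Rightarrow> nat \<Rightarrow> nat \<Rightarrow> ((nat \<Rightarrow> real) \<Rightarrow> cd) \<Rightarrow> kernel \<Rightarrow> cd \<Rightarrow> cd \<Rightarrow> cd" where
  "face_transform r n j h u p \<zeta> =
     (\<lambda>i. LINT t|lebesgue_on_coords ({1..n} - {j}). integrand r h u p \<zeta> (t(j := 0)) i)"

definition face_transform_exists ::
    "nat \<Rightarrow> nat \<Rightarrow> nat \<Rightarrow> ((nat \<Rightarrow> real) \<Rightarrow> cd) \<Rightarrow> kernel \<Rightarrow> cd \<Rightarrow> cd \<Rightarrow> bool" where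
  "face_transform_exists r n j h u p \<zeta> \<longleftrightarrow>
     (\<forall>i. integrable (lebesgue_on_coords ({1..n} - {j})) (\<lambda>t. integrand r h u p \<zeta> (t(j := 0)) i))"

definition shift_op :: "nat \<Rightarrow> (cd \<Rightarrow> cd) \<Rightarrow> cd \<Rightarrow> cd" where
  "shift_op k G \<zeta> = (\<lambda>i. - deriv (\<lambda>x. G (\<zeta>(k := x)) i) (\<zeta> k))"

definition shift_exists :: "nat \<Rightarrow> (cd \<Rightarrow> cd) \<Rightarrow> cd \<Rightarrow> bool" where
  "shift_exists k G \<zeta> \<longleftrightarrow> (\<forall>i. (\<lambda>x. G (\<zeta>(k := x)) i) differentiable (at (\<zeta> k)))"

text \<open>Parameters obey the convention that the coordinates of index \<open>m > n\<close> vanish.\<close>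

definition parameters :: "nat \<Rightarrow> nat \<Rightarrow> cd set" where
  "parameters r n = {z \<in> cd_carrier r. \<forall>m>n. z m = 0}"

end

theory Submission
  imports Defs
begin

text \<open>
  In the subalgebra generated by \<open>z\<close> the exponential is \<open>e\<^bsup>Re z\<^esup> (cos |w| + (sin |w| / |w|) w)\<close>
  with \<open>w = Im z\<close>. Hence for both kernels each coordinate of \<open>exp (-u(p,t;\<zeta>))\<close> has the form
  \<open>e\<^bsup>-(p\<^sub>0 (t\<^sub>1 + \<dots> + t\<^sub>n) + \<zeta>\<^sub>0)\<^esup> Q(p\<^sub>1 \<sigma>\<^sub>1(t) + \<zeta>\<^sub>1, p\<^sub>2 \<sigma>\<^sub>2(t) + \<zeta>\<^sub>2, \<dots>)\<close>, where \<open>Q\<close> is bounded with bounded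
  partial derivatives and \<open>\<sigma>\<^sub>k\<close> is linear with \<open>\<partial>\<sigma>\<^sub>k/\<partial>t\<^sub>j\<close> equal to \<open>1\<close> or \<open>0\<close>: it is \<open>1\<close> for
  \<open>k \<le> j\<close> (spherical) or \<open>k = j\<close> (Cartesian). So \<open>\<partial>/\<partial>t\<^sub>j\<close> acts on such a function as \<open>-p\<^sub>0\<close> plus
  the sum of \<open>p\<^sub>k \<partial>/\<partial>\<zeta>\<^sub>k\<close> over these \<open>k\<close>. Integration by parts in \<open>t\<^sub>j\<close>, Fubini's theorem and
  differentiation under the integral, all justified by the majorant \<open>e\<^bsup>(a - p\<^sub>0)(t\<^sub>1 + \<dots> + t\<^sub>n)\<^esup>\<close>, then
  give the formulas coordinatewise, and bilinearity of the product carries them to the algebra.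
\<close>

section \<open>The exponential in the Cayley-Dickson algebras\<close>

lemma cd_conj_nth: "i < 2 ^ r \<Longrightarrow> cd_conj r z i = (if i = 0 then z 0 else - z i)"
  by (induction r arbitrary: z i) (auto simp: cd_pair_def cd_fst_def cd_snd_def)

lemma cd_fst_nth: "i < 2 ^ r \<Longrightarrow> cd_fst r z i = z i"
  by (simp add: cd_fst_def)

lemma cd_snd_nth: "i < 2 ^ r \<Longrightarrow> cd_snd r z i = z (2 ^ r + i)"
  by (simp add: cd_snd_def)

text \<open>Encoding by a finite matrix of constants: linearity in each argument, dependence on the
  first \<open>N\<close> coordinates only and exchange with integrals can all be read off this one
  expression.\<close>

definition bilinear_coords :: "nat \<Rightarrow> (cd \<Rightarrow> cd \<Rightarrow> real) \<Rightarrow> bool" where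
  "bilinear_coords N \<phi> \<longleftrightarrow> (\<exists>c. \<forall>x y. \<phi> x y = (\<Sum>a<N. \<Sum>b<N. c a b * x a * y b))"

lemma bilinear_coords_base:
  assumes "a < N" "b < N"
  shows "bilinear_coords N (\<lambda>x y. x a * y b)"
  unfolding bilinear_coords_def
proof (intro exI allI)
  fix x y :: cd
  have "(\<Sum>a'<N. \<Sum>b'<N. (if a' = a \<and> b' = b then 1 else 0) * x a' * y b')
      = (\<Sum>a'<N. \<Sum>b'<N. if b' = b then (if a' = a then x a' * y b else 0) else 0)"
    by (intro sum.cong) auto
  also have "\<dots> = x a * y b" using assms by simp
  finally show "x a * y b
      = (\<Sum>a'<N. \<Sum>b'<N. (if a' = a \<and> b' = b then 1 else 0) * x a' * y b')" ..
qed

lemma bilinear_coords_zero: "bilinear_coords N (\<lambda>x y. 0)"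
  unfolding bilinear_coords_def by (rule exI[of _ "\<lambda>a b. 0"]) simp

lemma bilinear_coords_add:
  assumes "bilinear_coords N \<phi>" "bilinear_coords N \<psi>"
  shows "bilinear_coords N (\<lambda>x y. \<phi> x y + \<psi> x y)"
proof -
  obtain c where c: "\<And>x y. \<phi> x y = (\<Sum>a<N. \<Sum>b<N. c a b * x a * y b)"
    using assms(1) unfolding bilinear_coords_def by blast
  obtain d where d: "\<And>x y. \<psi> x y = (\<Sum>a<N. \<Sum>b<N. d a b * x a * y b)"
    using assms(2) unfolding bilinear_coords_def by blast
  show ?thesis unfolding bilinear_coords_def c d
    by (rule exI[of _ "\<lambda>a b. c a b + d a b"]) (simp add: sum.distrib distrib_right)
qed

lemma bilinear_coords_cmult:
  assumes "bilinear_coords N \<phi>"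
  shows "bilinear_coords N (\<lambda>x y. k * \<phi> x y)"
proof -
  obtain c where c: "\<And>x y. \<phi> x y = (\<Sum>a<N. \<Sum>b<N. c a b * x a * y b)"
    using assms unfolding bilinear_coords_def by blast
  show ?thesis unfolding bilinear_coords_def c
    by (rule exI[of _ "\<lambda>a b. k * c a b"]) (simp add: sum_distrib_left mult.assoc)
qed

lemma bilinear_coords_diff:
  assumes "bilinear_coords N \<phi>" "bilinear_coords N \<psi>"
  shows "bilinear_coords N (\<lambda>x y. \<phi> x y - \<psi> x y)"
  using bilinear_coords_add[OF assms(1) bilinear_coords_cmult[OF assms(2), of "-1"]] by simp

lemma bilinear_coords_sum:
  assumes "\<And>a. a \<in> A \<Longrightarrow> bilinear_coords N (\<phi> a)"
  shows "bilinear_coords N (\<lambda>x y. \<Sum>a\<in>A. \<phi> a x y)"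
  using assms
  by (induction A rule: infinite_finite_induct)
     (auto intro: bilinear_coords_zero bilinear_coords_add)

lemma bilinear_coords_swap:
  assumes "bilinear_coords N \<phi>"
  shows "bilinear_coords N (\<lambda>x y. \<phi> y x)"
proof -
  obtain c where c: "\<And>x y. \<phi> x y = (\<Sum>a<N. \<Sum>b<N. c a b * x a * y b)"
    using assms unfolding bilinear_coords_def by blast
  have "\<phi> y x = (\<Sum>a<N. \<Sum>b<N. c b a * x a * y b)" for x y
    unfolding c by (subst sum.swap) (simp add: mult_ac)
  then show ?thesis unfolding bilinear_coords_def by (intro exI) auto
qed

text \<open>The maps occurring in the recursion of \<open>cd_mult\<close> (lower half, upper half,
  conjugation) pick single coordinates up to sign, so substituting them only moves and rescales the
  constants.\<close>

lemma bilinear_coords_reindex: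
  assumes "bilinear_coords N \<phi>"
    and "\<And>a x. a < N \<Longrightarrow> X x a = s a * x (\<pi> a)" "\<And>a. a < N \<Longrightarrow> \<pi> a < M"
    and "\<And>a x. a < N \<Longrightarrow> Y x a = s' a * x (\<pi>' a)" "\<And>a. a < N \<Longrightarrow> \<pi>' a < M"
  shows "bilinear_coords M (\<lambda>x y. \<phi> (X x) (Y y))"
proof -
  obtain c where c: "\<And>x y. \<phi> x y = (\<Sum>a<N. \<Sum>b<N. c a b * x a * y b)"
    using assms(1) unfolding bilinear_coords_def by blast
  have eq: "\<phi> (X x) (Y y)
      = (\<Sum>a<N. \<Sum>b<N. (c a b * s a * s' b) * (x (\<pi> a) * y (\<pi>' b)))" for x y
    unfolding c by (intro sum.cong) (auto simp: assms mult_ac)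
  show ?thesis
    unfolding eq by (intro bilinear_coords_sum bilinear_coords_cmult bilinear_coords_base)
      (auto intro: assms)
qed

text \<open>Each of the four products in the recursion is a product of the previous level, evaluated
  at signed coordinate selections of \<open>x\<close> and \<open>y\<close>. In two of them the
  factor taken from \<open>y\<close> stands on the left, hence
  \<open>bilinear_coords_swap\<close>.\<close>

lemma cd_mult_bilinear: "bilinear_coords (2 ^ r) (\<lambda>x y. cd_mult r x y i)"
proof (induction r arbitrary: i)
  case 0
  show ?case using bilinear_coords_base[of 0 1 0]
    by (cases "i = 0") (auto intro: bilinear_coords_zero)
next
  case (Suc r)
  note reidx = bilinear_coords_reindex[where N = "2 ^ r" and M = "2 ^ Suc r"]
  \<comment> \<open>\<open>?lo\<close> and \<open>?hi\<close> locate the two halves among the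
    coordinates of the next level; \<open>?c\<close> holds the signs of conjugation.\<close>
  let ?lo = "id :: nat \<Rightarrow> nat" and ?hi = "\<lambda>a::nat. 2 ^ r + a"
  let ?c = "\<lambda>a::nat. if a = 0 then 1 else - 1 :: real"
  have 1: "bilinear_coords (2 ^ Suc r) (\<lambda>x y. cd_mult r (cd_fst r x) (cd_fst r y) i)" for i
    by (rule reidx[OF Suc, where s = "\<lambda>_. 1" and s' = "\<lambda>_. 1" and \<pi> = ?lo and \<pi>' = ?lo])
       (auto simp: cd_fst_nth)
  have 2: "bilinear_coords (2 ^ Suc r)
      (\<lambda>x y. cd_mult r (cd_conj r (cd_snd r y)) (cd_snd r x) i)" for i
    by (rule bilinear_coords_swap,
        rule reidx[OF Suc, where s = ?c and s' = "\<lambda>_. 1" and \<pi> = ?hi and \<pi>' = ?hi])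
       (auto simp: cd_snd_nth cd_conj_nth)
  have 3: "bilinear_coords (2 ^ Suc r) (\<lambda>x y. cd_mult r (cd_snd r y) (cd_fst r x) i)" for i
    by (rule bilinear_coords_swap,
        rule reidx[OF Suc, where s = "\<lambda>_. 1" and s' = "\<lambda>_. 1" and \<pi> = ?hi and \<pi>' = ?lo])
       (auto simp: cd_snd_nth cd_fst_nth)
  have 4: "bilinear_coords (2 ^ Suc r)
      (\<lambda>x y. cd_mult r (cd_snd r x) (cd_conj r (cd_fst r y)) i)" for i
    by (rule reidx[OF Suc, where s = "\<lambda>_. 1" and s' = ?c and \<pi> = ?hi and \<pi>' = ?lo])
       (auto simp: cd_snd_nth cd_fst_nth cd_conj_nth)
  consider "i < 2 ^ r" | "\<not> i < 2 ^ r" "i < 2 ^ Suc r" | "\<not> i < 2 ^ Suc r" "\<not> i < 2 ^ r"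
    by force
  then show ?case
  proof cases
    case lo: 1
    then show ?thesis
      using bilinear_coords_diff[OF 1[of i] 2[of i]] by (simp add: Let_def cd_pair_def)
  next
    case hi: 2
    then show ?thesis
      using bilinear_coords_add[OF 3[of "i - 2 ^ r"] 4[of "i - 2 ^ r"]]
      by (simp add: Let_def cd_pair_def)
  next
    case out: 3
    then show ?thesis by (simp add: Let_def cd_pair_def bilinear_coords_zero)
  qed
qed

lemma cd_mult_structure_constants:
  obtains c where "\<And>x y i. cd_mult r x y i = (\<Sum>a<2 ^ r. \<Sum>b<2 ^ r. c i a b * x a * y b)"
proof -
  have "\<forall>i. \<exists>c. \<forall>x y. cd_mult r x y i = (\<Sum>a<2 ^ r. \<Sum>b<2 ^ r. c a b * x a * y b)"
    using cd_mult_bilinear unfolding bilinear_coords_def by blast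
  from choice[OF this] show ?thesis using that by blast
qed

lemma cd_mult_lincomb_left:
  "cd_mult r (\<lambda>i. a * x i + b * y i) z k = a * cd_mult r x z k + b * cd_mult r y z k"
proof -
  obtain c where c: "\<And>x y i. cd_mult r x y i = (\<Sum>a<2 ^ r. \<Sum>b<2 ^ r. c i a b * x a * y b)"
    using cd_mult_structure_constants[of r] by blast
  show ?thesis by (simp add: c sum_distrib_left algebra_simps sum.distrib)
qed

lemma cd_mult_lincomb_right:
  "cd_mult r z (\<lambda>i. a * x i + b * y i) k = a * cd_mult r z x k + b * cd_mult r z y k"
proof -
  obtain c where c: "\<And>x y i. cd_mult r x y i = (\<Sum>a<2 ^ r. \<Sum>b<2 ^ r. c i a b * x a * y b)"
    using cd_mult_structure_constants[of r] by blast
  show ?thesis by (simp add: c sum_distrib_left algebra_simps sum.distrib)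
qed

lemma cd_mult_cong:
  assumes "\<And>i. i < 2 ^ r \<Longrightarrow> x i = x' i" "\<And>i. i < 2 ^ r \<Longrightarrow> y i = y' i"
  shows "cd_mult r x y = cd_mult r x' y'"
proof
  fix i
  obtain c where c: "\<And>x y i. cd_mult r x y i = (\<Sum>a<2 ^ r. \<Sum>b<2 ^ r. c i a b * x a * y b)"
    using cd_mult_structure_constants[of r] by blast
  show "cd_mult r x y i = cd_mult r x' y' i" by (simp add: c assms)
qed

lemma cd_mult_zero_left: "(\<And>i. i < 2 ^ r \<Longrightarrow> x i = 0) \<Longrightarrow> cd_mult r x y k = 0"
  using cd_mult_lincomb_left[of r 0 x 0 x y k] cd_mult_cong[of r x "\<lambda>i. 0" y y] by simp

lemma cd_mult_zero_right: "(\<And>i. i < 2 ^ r \<Longrightarrow> y i = 0) \<Longrightarrow> cd_mult r x y k = 0"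
  using cd_mult_lincomb_right[of r x 0 y 0 y k] cd_mult_cong[of r x x y "\<lambda>i. 0"] by simp

lemma cd_mult_outside: "2 ^ r \<le> i \<Longrightarrow> cd_mult r x y i = 0"
  by (cases r) (auto simp: Let_def cd_pair_def)

lemma cd_mult_neg_left: "cd_mult r (\<lambda>i. - x i) y k = - cd_mult r x y k"
  using cd_mult_lincomb_left[of r "-1" x 0 x y k] by simp

lemma cd_mult_neg_right: "cd_mult r x (\<lambda>i. - y i) k = - cd_mult r x y k"
  using cd_mult_lincomb_right[of r x "-1" y 0 y k] by simp

text \<open>Both unit laws go through one induction: the upper half of a product contains
  \<delta>\<xi>, so a unit on the left at one level acts from the right at the level below.\<close>

lemma cd_mult_one:
  shows cd_mult_one_left: "i < 2 ^ r \<Longrightarrow> cd_mult r (cd_basis 0) y i = y i"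
    and cd_mult_one_right: "i < 2 ^ r \<Longrightarrow> cd_mult r x (cd_basis 0) i = x i"
proof (induction r arbitrary: x y i)
  case 0
  { case 1 then show ?case by (simp add: cd_basis_def) }
  { case 2 then show ?case by (simp add: cd_basis_def) }
next
  case (Suc r)
  have fst1: "cd_fst r (cd_basis 0) = cd_basis 0" by (auto simp: cd_fst_def cd_basis_def)
  have snd1: "cd_snd r (cd_basis 0) = (\<lambda>i. 0)" by (auto simp: cd_snd_def cd_basis_def)
  have conj1: "i < 2 ^ r \<Longrightarrow> cd_conj r (cd_basis 0) i = cd_basis 0 i" for i
    by (simp add: cd_conj_nth cd_basis_def)
  have conj0: "i < 2 ^ r \<Longrightarrow> cd_conj r (\<lambda>i. 0) i = 0" for i
    by (simp add: cd_conj_nth)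
  { case 1
    then show ?case
      by (auto simp: Let_def cd_pair_def fst1 snd1 Suc.IH cd_mult_zero_left cd_mult_zero_right
          cd_fst_nth cd_snd_nth) }
  { case 2
    then show ?case
      by (auto simp: Let_def cd_pair_def fst1 snd1 Suc.IH cd_mult_zero_left conj0
          cd_mult_cong[OF refl conj1, of r] cd_fst_nth cd_snd_nth) }
qed

section \<open>Conjugation, real part and norm\<close>

lemma sum_lessThan_double: "(\<Sum>a<2 ^ Suc r. g a) = (\<Sum>a<2 ^ r. g a) + (\<Sum>a<2 ^ r. g (2 ^ r + a))"
  for g :: "nat \<Rightarrow> real"
proof -
  have "(\<Sum>a<m + n. g a) = (\<Sum>a<m. g a) + (\<Sum>a<n. g (m + a))" for m n
    by (induction n) auto
  from this[of "2 ^ r" "2 ^ r"] show ?thesis by (simp add: mult_2)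
qed

text \<open>In the upper half the product of \<eta> with the conjugate of \<xi> occurs with both
  signs and cancels; the lower half adds the sums of squares of the two halves.\<close>

lemma cd_mult_conj_left:
  "cd_mult r (cd_conj r z) z i = (if i = 0 then \<Sum>a<2 ^ r. (z a)\<^sup>2 else 0)"
proof (induction r arbitrary: z i)
  case 0
  show ?case by (simp add: power2_eq_square)
next
  case (Suc r)
  let ?\<xi> = "cd_fst r z" and ?\<eta> = "cd_snd r z"
  have [simp]: "cd_fst r (cd_conj (Suc r) z) = cd_fst r (cd_conj r ?\<xi>)"
    by (auto simp: cd_fst_def cd_pair_def)
  have [simp]: "cd_snd r (cd_conj (Suc r) z) = (\<lambda>i. - ?\<eta> i)"
    by (auto simp: cd_snd_def cd_pair_def)
  have 1: "cd_mult r (cd_fst r (cd_conj r ?\<xi>)) y = cd_mult r (cd_conj r ?\<xi>) y" for y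
    by (rule cd_mult_cong) (auto simp: cd_fst_nth)
  have 2: "cd_mult r y (cd_fst r (cd_conj r ?\<xi>)) = cd_mult r y (cd_conj r ?\<xi>)" for y
    by (rule cd_mult_cong) (auto simp: cd_fst_nth)
  have "cd_mult (Suc r) (cd_conj (Suc r) z) z = cd_pair r
      (\<lambda>i. cd_mult r (cd_conj r ?\<xi>) ?\<xi> i + cd_mult r (cd_conj r ?\<eta>) ?\<eta> i) (\<lambda>i. 0)"
    by (auto simp: Let_def 1 2 cd_mult_neg_left cd_mult_neg_right simp del: cd_conj.simps)
  then show ?case
    unfolding cd_pair_def Suc sum_lessThan_double
    by (auto simp: cd_fst_nth cd_snd_nth simp del: cd_mult.simps cd_conj.simps)
qed

text \<open>The full sum counts index 0 with the wrong sign, and \<open>2 * x 0 * y 0\<close>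
  corrects this. The formula identifies \<open>cd_norm\<close> with the Euclidean norm of the
  coordinates.\<close>

lemma cd_mult_nth_0:
  "cd_mult r x y 0 = 2 * x 0 * y 0 - (\<Sum>a<2 ^ r. x a * y a)"
proof (induction r arbitrary: x y)
  case 0
  show ?case by simp
next
  case (Suc r)
  have "cd_mult (Suc r) x y 0
      = 2 * x 0 * y 0 - (\<Sum>a<2 ^ r. x a * y a)
        - (2 * y (2 ^ r) * x (2 ^ r) - (\<Sum>a<2 ^ r. cd_conj r (cd_snd r y) a * x (2 ^ r + a)))"
    by (simp add: Let_def cd_pair_def Suc cd_fst_def cd_snd_def cd_conj_nth)
  also have "(\<Sum>a<2 ^ r. cd_conj r (cd_snd r y) a * x (2 ^ r + a))
      = (\<Sum>a<2 ^ r. (if a = 0 then 2 * y (2 ^ r) * x (2 ^ r) else 0) - x (2 ^ r + a) * y (2 ^ r + a))"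
    by (rule sum.cong) (auto simp: cd_conj_nth cd_snd_nth)
  finally show ?case
    unfolding sum_lessThan_double by (simp add: sum_subtractf del: cd_mult.simps)
qed

lemma cd_Re_eq: "cd_Re r z = z 0"
  by (simp add: cd_Re_def cd_conj_nth)

lemma cd_norm_eq: "cd_norm r z = sqrt (\<Sum>a<2 ^ r. (z a)\<^sup>2)"
proof -
  have "(\<Sum>a<2 ^ r. z a * cd_conj r z a)
      = (\<Sum>a<2 ^ r. (if a = 0 then 2 * (z 0)\<^sup>2 else 0) - (z a)\<^sup>2)"
    by (rule sum.cong) (auto simp: cd_conj_nth power2_eq_square)
  then show ?thesis
    by (simp add: cd_norm_def cd_mult_nth_0 cd_conj_nth power2_eq_square sum_subtractf)
qed

lemma abs_nth_le_cd_norm: "i < 2 ^ r \<Longrightarrow> \<bar>z i\<bar> \<le> cd_norm r z"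
  unfolding cd_norm_eq by (rule real_le_rsqrt) (auto intro: member_le_sum)

text \<open>A purely imaginary \<open>z\<close> satisfies conj z = - z, so its square is the
  negative of the product of conj z and z.\<close>

lemma cd_mult_imaginary_self:
  assumes "z 0 = 0"
  shows "cd_mult r z z i = (if i = 0 then - (\<Sum>a<2 ^ r. (z a)\<^sup>2) else 0)"
proof -
  have "cd_mult r (cd_conj r z) z = cd_mult r (\<lambda>i. - z i) z"
    by (rule cd_mult_cong) (auto simp: cd_conj_nth assms)
  then have "- cd_mult r z z i = cd_mult r (cd_conj r z) z i"
    by (simp add: cd_mult_neg_left)
  then show ?thesis unfolding cd_mult_conj_left by (auto split: if_splits)
qed

text \<open>The subalgebra generated by \<open>z\<close> is a copy of the complex plane with imaginary unit
  \<open>Im z / |Im z|\<close>, hence the powers of \<open>z\<close> are read off the powers of \<open>Re z + i |Im z|\<close>.\<close>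

lemma cd_power_eq_complex_power:
  fixes r :: nat and z :: cd
  defines "\<rho> \<equiv> sqrt (\<Sum>a\<in>{1..<2 ^ r}. (z a)\<^sup>2)"
  shows "\<exists>B. \<rho> * B = Im (Complex (z 0) \<rho> ^ k) \<and>
    cd_power r z k = (\<lambda>i. if i = 0 then Re (Complex (z 0) \<rho> ^ k) else if i < 2 ^ r then B * z i else 0)"
proof (induction k)
  case 0
  show ?case by (rule exI[of _ 0]) (auto simp: cd_basis_def)
next
  case (Suc k)
  let ?c = "Complex (z 0) \<rho>"
  obtain B where B: "\<rho> * B = Im (?c ^ k)"
    "cd_power r z k = (\<lambda>i. if i = 0 then Re (?c ^ k) else if i < 2 ^ r then B * z i else 0)"
    using Suc by blast
  \<comment> \<open>\<open>w\<close> is the imaginary part of \<open>z\<close>. Below index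
    \<open>2 ^ r\<close>, \<open>z\<close> is \<open>z 0\<close> plus \<open>w\<close>, and the
    \<open>k\<close>-th power is \<open>Re (?c ^ k)\<close> plus \<open>B\<close> times
    \<open>w\<close>.\<close>
  define w where "w = (\<lambda>i. if i = 0 then 0 else z i)"
  have \<rho>2: "\<rho> * \<rho> = (\<Sum>a<2 ^ r. (w a)\<^sup>2)"
  proof -
    have "(\<Sum>a<2 ^ r. (w a)\<^sup>2) = (\<Sum>a\<in>{1..<2 ^ r}. (z a)\<^sup>2)"
      by (rule sum.mono_neutral_cong_right) (auto simp: w_def)
    then show ?thesis by (simp add: \<rho>_def sum_nonneg)
  qed
  have w0: "w 0 = 0" by (simp add: w_def)
  have ww: "cd_mult r w w i = (if i = 0 then - (\<rho> * \<rho>) else 0)" for i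
    using cd_mult_imaginary_self[of w r i, OF w0] unfolding \<rho>2 .
  have ReIm: "Re (?c ^ Suc k) = z 0 * Re (?c ^ k) - \<rho> * \<rho> * B"
    by (simp add: B(1)[symmetric])
  have power: "cd_power r z (Suc k) = cd_mult r (\<lambda>i. z 0 * cd_basis 0 i + 1 * w i)
      (\<lambda>i. Re (?c ^ k) * cd_basis 0 i + B * w i)"
    unfolding cd_power.simps B by (rule cd_mult_cong) (auto simp: cd_basis_def w_def)
  \<comment> \<open>Expanding the product of these two sums, with the square of \<open>w\<close>
    equal to the scalar - \<rho> * \<rho>, gives the new factor of \<open>w\<close> and thus the
    next witness. Characterising the witness by \<rho> * B rather than by a quotient also covers
    \<rho> = 0.\<close>
  have "cd_power r z (Suc k) i = (if i = 0 then Re (?c ^ Suc k)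
      else if i < 2 ^ r then (Re (?c ^ k) + z 0 * B) * z i else 0)" for i
  proof (cases "i < 2 ^ r")
    case True
    show ?thesis
      unfolding power ReIm cd_mult_lincomb_left cd_mult_lincomb_right ww
        cd_mult_one_left[OF True] cd_mult_one_right[OF True]
      using True by (simp add: w_def cd_basis_def algebra_simps)
  next
    case False
    moreover have "i \<noteq> 0" using False by (cases i) auto
    ultimately show ?thesis by (simp add: cd_mult_outside)
  qed
  then have "cd_power r z (Suc k) = (\<lambda>i. if i = 0 then Re (?c ^ Suc k)
      else if i < 2 ^ r then (Re (?c ^ k) + z 0 * B) * z i else 0)"
    by blast
  moreover have "\<rho> * (Re (?c ^ k) + z 0 * B) = Im (?c ^ Suc k)"
    by (simp add: B(1)[symmetric] algebra_simps)
  ultimately show ?case by blast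
qed

text \<open>Coordinatewise, the exponential series is a real multiple of the real or imaginary part
  of the complex exponential series at \<open>Complex (z 0) \<rho>\<close>.\<close>

lemma cd_exp_eq:
  fixes r :: nat and z :: cd
  defines "\<rho> \<equiv> sqrt (\<Sum>a\<in>{1..<2 ^ r}. (z a)\<^sup>2)"
  assumes "i < 2 ^ r"
  shows "cd_exp r z i = exp (z 0) * (if i = 0 then cos \<rho> else sin \<rho> / \<rho> * z i)"
proof -
  let ?c = "Complex (z 0) \<rho>"
  have "(\<lambda>k. ?c ^ k /\<^sub>R fact k) sums exp ?c" by (rule exp_converges)
  then have Re: "(\<lambda>k. Re (?c ^ k) / fact k) sums Re (exp ?c)"
    and Im: "(\<lambda>k. Im (?c ^ k) / fact k) sums Im (exp ?c)"
    by (auto dest: sums_Re sums_Im simp: divide_inverse mult.commute)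
  have "\<exists>B. \<forall>k. \<rho> * B k = Im (?c ^ k) \<and> cd_power r z k =
      (\<lambda>i. if i = 0 then Re (?c ^ k) else if i < 2 ^ r then B k * z i else 0)"
    unfolding \<rho>_def by (intro choice allI cd_power_eq_complex_power)
  then obtain B where B: "\<And>k. \<rho> * B k = Im (?c ^ k)" "\<And>k. cd_power r z k =
      (\<lambda>i. if i = 0 then Re (?c ^ k) else if i < 2 ^ r then B k * z i else 0)"
    by blast
  show ?thesis
  proof (cases "i = 0")
    case True
    then show ?thesis using sums_unique[OF Re] by (simp add: cd_exp_def B Re_exp)
  next
    case False
    have "(\<lambda>k. B k * z i / fact k) sums (exp (z 0) * (sin \<rho> / \<rho> * z i))"
    proof (cases "\<rho> = 0")
      case True
      \<comment> \<open>For \<rho> = 0 the quotient sin \<rho> / \<rho> is 0 by the convention for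
        division by zero; this is harmless because every imaginary coordinate then vanishes.\<close>
      then have "z i = 0" using False assms(2) by (simp add: \<rho>_def sum_nonneg_eq_0_iff)
      then show ?thesis by simp
    next
      case False
      have "(\<lambda>k. (z i / \<rho>) * (Im (?c ^ k) / fact k)) sums ((z i / \<rho>) * Im (exp ?c))"
        by (intro sums_mult Im)
      then show ?thesis using False by (simp add: B(1)[symmetric] Im_exp mult_ac)
    qed
    from sums_unique[OF this] show ?thesis
      using False assms(2) by (simp add: cd_exp_def B(2))
  qed
qed

section \<open>Bounded functions with bounded derivatives\<close>

text \<open>
  The last clause is the chain rule along differentiable curves; only the coordinates in \<open>A\<close>
  may influence \<open>Q\<close>.
\<close>

definition bounded_C1 :: "nat set \<Rightarrow> (cd \<Rightarrow> real) \<Rightarrow> (nat \<Rightarrow> cd \<Rightarrow> real) \<Rightarrow> real \<Rightarrow> bool" where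
  "bounded_C1 A Q D B \<longleftrightarrow>
     Q \<in> borel_measurable borel \<and> (\<forall>k\<in>A. D k \<in> borel_measurable borel) \<and>
     (\<forall>\<theta>. \<bar>Q \<theta>\<bar> \<le> B \<and> (\<forall>k\<in>A. \<bar>D k \<theta>\<bar> \<le> B)) \<and>
     (\<forall>\<phi> \<phi>' x. (\<forall>k\<in>A. (\<phi> k has_real_derivative \<phi>' k) (at x)) \<longrightarrow>
        ((\<lambda>y. Q (\<lambda>k. \<phi> k y)) has_real_derivative (\<Sum>k\<in>A. D k (\<lambda>k. \<phi> k x) * \<phi>' k)) (at x))"

lemma measurable_coord [measurable]: "(\<lambda>\<theta>::cd. \<theta> k) \<in> borel_measurable borel"
  by (intro borel_measurable_continuous_onI continuous_on_product_coordinates)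

lemma bounded_C1_const: "bounded_C1 A (\<lambda>\<theta>. c) (\<lambda>k \<theta>. 0) \<bar>c\<bar>"
  by (simp add: bounded_C1_def)

lemma bounded_C1_coord:
  assumes A: "finite A" "k \<in> A"
    and g: "\<And>x. (g has_real_derivative g' x) (at x)" "g' \<in> borel_measurable borel"
    and B: "\<And>x. \<bar>g x\<bar> \<le> B" "\<And>x. \<bar>g' x\<bar> \<le> B"
  shows "bounded_C1 A (\<lambda>\<theta>. g (\<theta> k)) (\<lambda>l \<theta>. if l = k then g' (\<theta> k) else 0) B"
proof -
  have "continuous_on UNIV g"
    using g(1) by (auto intro!: DERIV_isCont continuous_at_imp_continuous_on)
  then have [measurable]: "g \<in> borel_measurable borel"
    by (rule borel_measurable_continuous_onI)
  note g(2)[measurable]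
  have "0 \<le> B" using B(1)[of 0] by linarith
  moreover have "((\<lambda>y. g (\<phi> k y)) has_real_derivative
      (\<Sum>l\<in>A. (if l = k then g' (\<phi> k x) else 0) * \<phi>' l)) (at x)"
    if "\<forall>k\<in>A. (\<phi> k has_real_derivative \<phi>' k) (at x)" for \<phi> \<phi>' x
  proof -
    have "(\<Sum>l\<in>A. (if l = k then g' (\<phi> k x) else 0) * \<phi>' l)
        = (\<Sum>l\<in>A. if l = k then g' (\<phi> k x) * \<phi>' l else 0)"
      by (intro sum.cong) auto
    also have "\<dots> = g' (\<phi> k x) * \<phi>' k"
      using A by simp
    finally show ?thesis using DERIV_chain2[OF g(1)] that A(2) by simp
  qed
  ultimately show ?thesis
    using B unfolding bounded_C1_def by auto
qed

text \<open>The factor 2 in the bound accounts for the two terms of the Leibniz rule.\<close>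

lemma bounded_C1_mult:
  assumes "bounded_C1 A P D B" "bounded_C1 A Q E C"
  shows "bounded_C1 A (\<lambda>\<theta>. P \<theta> * Q \<theta>) (\<lambda>k \<theta>. D k \<theta> * Q \<theta> + P \<theta> * E k \<theta>) (2 * B * C)"
proof -
  have b: "\<bar>P \<theta>\<bar> \<le> B" "\<bar>Q \<theta>\<bar> \<le> C" for \<theta>
    using assms unfolding bounded_C1_def by auto
  have d: "\<bar>D k \<theta>\<bar> \<le> B" "\<bar>E k \<theta>\<bar> \<le> C" if "k \<in> A" for k \<theta>
    using assms that unfolding bounded_C1_def by auto
  have nonneg: "0 \<le> B" "0 \<le> C" using b[of undefined] by linarith+
  have prod: "\<bar>P \<theta> * Q \<theta>\<bar> \<le> B * C" for \<theta>
    unfolding abs_mult by (intro mult_mono b nonneg) auto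
  have "\<bar>D k \<theta> * Q \<theta> + P \<theta> * E k \<theta>\<bar> \<le> 2 * B * C" if "k \<in> A" for k \<theta>
    unfolding mult_2 distrib_right
    by (rule order_trans[OF abs_triangle_ineq], intro add_mono)
       (auto simp: abs_mult intro!: mult_mono b d nonneg that)
  moreover have "\<bar>P \<theta> * Q \<theta>\<bar> \<le> 2 * B * C" for \<theta>
    using prod[of \<theta>] nonneg mult_nonneg_nonneg[OF nonneg] by linarith
  moreover have "((\<lambda>y. P (\<lambda>k. \<phi> k y) * Q (\<lambda>k. \<phi> k y)) has_real_derivative
      (\<Sum>k\<in>A. (D k (\<lambda>k. \<phi> k x) * Q (\<lambda>k. \<phi> k x) + P (\<lambda>k. \<phi> k x) * E k (\<lambda>k. \<phi> k x)) * \<phi>' k)) (at x)"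
    if \<phi>: "\<forall>k\<in>A. (\<phi> k has_real_derivative \<phi>' k) (at x)" for \<phi> \<phi>' x
  proof -
    have "((\<lambda>y. P (\<lambda>k. \<phi> k y)) has_real_derivative (\<Sum>k\<in>A. D k (\<lambda>k. \<phi> k x) * \<phi>' k)) (at x)"
      "((\<lambda>y. Q (\<lambda>k. \<phi> k y)) has_real_derivative (\<Sum>k\<in>A. E k (\<lambda>k. \<phi> k x) * \<phi>' k)) (at x)"
      using assms \<phi> unfolding bounded_C1_def by auto
    from DERIV_mult[OF this] show ?thesis
      by (simp add: sum_distrib_left sum_distrib_right sum.distrib algebra_simps)
  qed
  ultimately show ?thesis
    using assms unfolding bounded_C1_def
    by (auto intro!: borel_measurable_add borel_measurable_times)
qed

lemma bounded_C1_mult_ex: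
  "\<exists>D B. bounded_C1 A P D B \<Longrightarrow> \<exists>D B. bounded_C1 A Q D B \<Longrightarrow>
    \<exists>D B. bounded_C1 A (\<lambda>\<theta>. P \<theta> * Q \<theta>) D B"
  by (blast intro: bounded_C1_mult)

lemma bounded_C1_prod:
  assumes "\<And>l. l \<in> L \<Longrightarrow> \<exists>D B. bounded_C1 A (Q l) D B"
  shows "\<exists>D B. bounded_C1 A (\<lambda>\<theta>. \<Prod>l\<in>L. Q l \<theta>) D B"
  using assms
proof (induction L rule: infinite_finite_induct)
  case (insert l L)
  then have "\<exists>D B. bounded_C1 A (Q l) D B" "\<exists>D B. bounded_C1 A (\<lambda>\<theta>. \<Prod>l\<in>L. Q l \<theta>) D B"
    by blast+
  from bounded_C1_mult_ex[OF this] show ?case using insert.hyps by simp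
qed (use bounded_C1_const[of A 1] in auto)

lemma bounded_C1_sin: "finite A \<Longrightarrow> k \<in> A \<Longrightarrow> \<exists>D B. bounded_C1 A (\<lambda>\<theta>. sin (\<theta> k)) D B"
  using bounded_C1_coord[of A k sin cos 1, OF _ _ DERIV_sin] by auto

lemma bounded_C1_cos: "finite A \<Longrightarrow> k \<in> A \<Longrightarrow> \<exists>D B. bounded_C1 A (\<lambda>\<theta>. cos (\<theta> k)) D B"
  using bounded_C1_coord[of A k cos "\<lambda>x. - sin x" 1, OF _ _ DERIV_cos] by auto

lemma bounded_C1_uminus_ex:
  "\<exists>D B. bounded_C1 A Q D B \<Longrightarrow> \<exists>D B. bounded_C1 A (\<lambda>\<theta>. - Q \<theta>) D B"
  using bounded_C1_mult_ex[of A "\<lambda>_. -1" Q] bounded_C1_const[of A "-1"] by auto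

section \<open>Cosine and normalised sine of the Euclidean norm\<close>

lemma summable_le_inverse_fact:
  fixes c :: "nat \<Rightarrow> real"
  assumes "\<And>n. \<bar>c n\<bar> \<le> inverse (fact n)"
  shows "summable (\<lambda>n. c n * y ^ n)"
proof (rule summable_comparison_test')
  show "summable (\<lambda>n. inverse (fact n) * \<bar>y\<bar> ^ n)" by (rule summable_exp)
  show "norm (c n * y ^ n) \<le> inverse (fact n) * \<bar>y\<bar> ^ n" if "n \<ge> 0" for n
    using assms[of n] by (simp add: abs_mult power_abs mult_right_mono)
qed

text \<open>Entire functions \<open>C\<close> and \<open>S\<close> with \<open>C (x\<^sup>2) = cos x\<close> and \<open>S (x\<^sup>2) = sin x / x\<close> make
  \<open>cos |w|\<close> and \<open>(sin |w| / |w|) w\<close> smooth at \<open>w = 0\<close>.\<close>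

lemma cos_as_function_of_square:
  obtains C C' :: "real \<Rightarrow> real" where
    "\<And>x. C (x\<^sup>2) = cos x" "\<And>y. (C has_real_derivative C' y) (at y)"
    "C' \<in> borel_measurable borel"
proof -
  define c :: "nat \<Rightarrow> real" where "c n = (- 1) ^ n / fact (2 * n)" for n
  have sm: "summable (\<lambda>n. c n * y ^ n)" for y
    by (rule summable_le_inverse_fact)
       (simp add: c_def abs_mult power_abs divide_inverse fact_mono le_imp_inverse_le)
  define C where "C y = (\<Sum>n. c n * y ^ n)" for y
  define C' where "C' y = (\<Sum>n. diffs c n * y ^ n)" for y
  have "C (x\<^sup>2) = cos x" for x
    using sums_unique[OF cos_paired[of x]] by (simp add: C_def c_def power_mult)
  moreover have "(C has_real_derivative C' y) (at y)" for y
    unfolding C_def C'_def by (rule termdiffs_strong_converges_everywhere) (rule sm)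
  moreover have "isCont C' y" for y
    unfolding C'_def
    by (rule isCont_powser_converges_everywhere, rule termdiff_converges_all, rule sm)
  then have "C' \<in> borel_measurable borel"
    by (intro borel_measurable_continuous_onI) (simp add: continuous_at_imp_continuous_on)
  ultimately show thesis by (rule that)
qed

lemma sinc_as_function_of_square:
  obtains S S' :: "real \<Rightarrow> real" where
    "\<And>x. x * S (x\<^sup>2) = sin x" "\<And>y. (S has_real_derivative S' y) (at y)"
    "S' \<in> borel_measurable borel" "S 0 = 1"
proof -
  define c :: "nat \<Rightarrow> real" where "c n = (- 1) ^ n / fact (2 * n + 1)" for n
  have sm: "summable (\<lambda>n. c n * y ^ n)" for y
    by (rule summable_le_inverse_fact)
       (simp add: c_def abs_mult power_abs divide_inverse fact_mono le_imp_inverse_le del: fact_Suc)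
  define S where "S y = (\<Sum>n. c n * y ^ n)" for y
  define S' where "S' y = (\<Sum>n. diffs c n * y ^ n)" for y
  have "x * S (x\<^sup>2) = sin x" for x
  proof -
    have "(\<lambda>n. x * (c n * (x\<^sup>2) ^ n)) sums (x * S (x\<^sup>2))"
      unfolding S_def by (intro sums_mult summable_sums sm)
    moreover have "(\<lambda>n. x * (c n * (x\<^sup>2) ^ n)) sums sin x"
      using sin_paired[of x] by (simp add: c_def mult_ac flip: power_mult del: fact_Suc)
    ultimately show ?thesis by (rule sums_unique2)
  qed
  moreover have "(S has_real_derivative S' y) (at y)" for y
    unfolding S_def S'_def by (rule termdiffs_strong_converges_everywhere) (rule sm)
  moreover have "isCont S' y" for y
    unfolding S'_def
    by (rule isCont_powser_converges_everywhere, rule termdiff_converges_all, rule sm)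
  then have "S' \<in> borel_measurable borel"
    by (intro borel_measurable_continuous_onI) (simp add: continuous_at_imp_continuous_on)
  \<comment> \<open>The identity x * S (x^2) = sin x says nothing about \<open>S\<close> at 0, so
    this value is recorded separately; the bound on \<open>S\<close> uses it.\<close>
  moreover have "S 0 = 1"
    unfolding S_def powser_zero by (simp add: c_def)
  ultimately show thesis by (rule that)
qed

lemma abs_coord_le_sqrt_sum:
  fixes \<theta> :: cd
  shows "finite A \<Longrightarrow> k \<in> A \<Longrightarrow> \<bar>\<theta> k\<bar> \<le> sqrt (\<Sum>a\<in>A. (\<theta> a)\<^sup>2)"
  by (rule real_le_rsqrt) (auto intro: member_le_sum)

lemma DERIV_comp_sum_squares:
  assumes "finite A" "(C has_real_derivative C') (at (\<Sum>a\<in>A. (\<phi> a x)\<^sup>2))"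
    and "\<And>k. k \<in> A \<Longrightarrow> (\<phi> k has_real_derivative \<phi>' k) (at x)"
  shows "((\<lambda>y. C (\<Sum>a\<in>A. (\<phi> a y)\<^sup>2)) has_real_derivative
    (\<Sum>k\<in>A. (2 * \<phi> k x * C') * \<phi>' k)) (at x)"
proof -
  have "((\<lambda>y. \<Sum>a\<in>A. (\<phi> a y)\<^sup>2) has_real_derivative (\<Sum>k\<in>A. 2 * \<phi> k x * \<phi>' k)) (at x)"
    using assms(3) by (auto intro!: derivative_eq_intros sum.cong)
  from DERIV_chain2[OF assms(2) this] show ?thesis
    by (simp add: sum_distrib_left mult_ac)
qed

text \<open>With x the norm of \<theta>, the partial derivative 2 \<theta>_k C'(x^2) is at most |2 x
  C'(x^2)| in absolute value, because |\<theta>_k| \<le> x.\<close>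

lemma bounded_C1_cos_norm:
  assumes A: "finite A"
  shows "\<exists>D B. bounded_C1 A (\<lambda>\<theta>. cos (sqrt (\<Sum>a\<in>A. (\<theta> a)\<^sup>2))) D B"
proof -
  obtain C C' :: "real \<Rightarrow> real" where C: "\<And>x. C (x\<^sup>2) = cos x"
    and C': "\<And>y. (C has_real_derivative C' y) (at y)" and [measurable]: "C' \<in> borel_measurable borel"
    using cos_as_function_of_square by blast
  have eq: "cos (sqrt (\<Sum>a\<in>A. (\<theta> a)\<^sup>2)) = C (\<Sum>a\<in>A. (\<theta> a)\<^sup>2)" for \<theta> :: cd
    by (simp add: sum_nonneg flip: C)
  \<comment> \<open>Differentiating C (x^2) = cos x in two ways identifies 2 x C'(x^2) with - sin x,
    so no bound on \<open>C'\<close> itself enters.\<close>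
  have bd: "\<bar>2 * x * C' (x\<^sup>2)\<bar> \<le> 1" for x
  proof -
    have "((\<lambda>x. C (x\<^sup>2)) has_real_derivative (C' (x\<^sup>2) * (2 * x))) (at x)"
      by (rule DERIV_chain2[OF C']) (auto intro!: derivative_eq_intros)
    moreover have "((\<lambda>x. C (x\<^sup>2)) has_real_derivative (- sin x)) (at x)"
      unfolding C by (auto intro!: derivative_eq_intros)
    ultimately have "C' (x\<^sup>2) * (2 * x) = - sin x" by (rule DERIV_unique)
    then have "\<bar>2 * x * C' (x\<^sup>2)\<bar> = \<bar>sin x\<bar>" by (simp add: mult_ac)
    then show ?thesis by simp
  qed
  have bd': "\<bar>2 * \<theta> k * C' (\<Sum>a\<in>A. (\<theta> a)\<^sup>2)\<bar> \<le> 1" if "k \<in> A" for k and \<theta> :: cd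
  proof -
    let ?x = "sqrt (\<Sum>a\<in>A. (\<theta> a)\<^sup>2)"
    have "\<bar>2 * \<theta> k * C' (?x\<^sup>2)\<bar> \<le> \<bar>2 * ?x * C' (?x\<^sup>2)\<bar>"
      using abs_coord_le_sqrt_sum[OF A that, of \<theta>]
      by (simp add: abs_mult mult_right_mono sum_nonneg)
    also have "\<dots> \<le> 1" by (rule bd)
    finally show ?thesis by (simp add: sum_nonneg)
  qed
  have "bounded_C1 A (\<lambda>\<theta>. cos (sqrt (\<Sum>a\<in>A. (\<theta> a)\<^sup>2)))
      (\<lambda>k \<theta>. 2 * \<theta> k * C' (\<Sum>a\<in>A. (\<theta> a)\<^sup>2)) 1"
    unfolding bounded_C1_def
  proof (intro conjI ballI allI impI)
    show "((\<lambda>y. cos (sqrt (\<Sum>a\<in>A. (\<phi> a y)\<^sup>2))) has_real_derivative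
        (\<Sum>k\<in>A. 2 * \<phi> k x * C' (\<Sum>a\<in>A. (\<phi> a x)\<^sup>2) * \<phi>' k)) (at x)"
      if "\<forall>k\<in>A. (\<phi> k has_real_derivative \<phi>' k) (at x)" for \<phi> \<phi>' x
      unfolding eq using DERIV_comp_sum_squares[OF A C', where \<phi> = \<phi> and \<phi>' = \<phi>'] that by simp
  qed (auto intro: bd' simp: abs_cos_le_one)
  then show ?thesis by blast
qed

text \<open>The function is S(x^2) \<theta>_m with x the norm of \<theta>. Differentiating x S(x^2)
  = sin x gives 2 x^2 S'(x^2) = cos x - S(x^2), of absolute value at most 2; the product rule adds
  one term bounded by 1, which gives the constant 3.\<close>

lemma bounded_C1_sinc_norm:
  assumes A: "finite A" and m: "m \<in> A"
  shows "\<exists>D B. bounded_C1 A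
    (\<lambda>\<theta>. sin (sqrt (\<Sum>a\<in>A. (\<theta> a)\<^sup>2)) / sqrt (\<Sum>a\<in>A. (\<theta> a)\<^sup>2) * \<theta> m) D B"
proof -
  obtain S S' :: "real \<Rightarrow> real" where S: "\<And>x. x * S (x\<^sup>2) = sin x"
    and S': "\<And>y. (S has_real_derivative S' y) (at y)" and [measurable]: "S' \<in> borel_measurable borel"
    and S0: "S 0 = 1"
    using sinc_as_function_of_square by blast
  have "continuous_on UNIV S"
    using S' by (auto intro!: DERIV_isCont continuous_at_imp_continuous_on)
  then have [measurable]: "S \<in> borel_measurable borel"
    by (rule borel_measurable_continuous_onI)
  let ?\<rho> = "\<lambda>\<theta>::cd. sqrt (\<Sum>a\<in>A. (\<theta> a)\<^sup>2)"
  let ?D = "\<lambda>k \<theta>. 2 * \<theta> k * S' (\<Sum>a\<in>A. (\<theta> a)\<^sup>2) * \<theta> m + (if k = m then S (\<Sum>a\<in>A. (\<theta> a)\<^sup>2) else 0)"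
  have le: "\<bar>\<theta> k\<bar> \<le> ?\<rho> \<theta>" if "k \<in> A" for \<theta> k
    using abs_coord_le_sqrt_sum[OF A that] .
  have sq: "(?\<rho> \<theta>)\<^sup>2 = (\<Sum>a\<in>A. (\<theta> a)\<^sup>2)" for \<theta>
    by (simp add: sum_nonneg)
  have eq: "sin (?\<rho> \<theta>) / ?\<rho> \<theta> * \<theta> m = S (\<Sum>a\<in>A. (\<theta> a)\<^sup>2) * \<theta> m" for \<theta>
  proof (cases "?\<rho> \<theta> = 0")
    case True
    \<comment> \<open>At norm 0 the left side is 0 by division by zero, and the right side is 0
      because \<open>\<theta> m\<close> is.\<close>
    then show ?thesis using le[OF m, of \<theta>] by simp
  next
    case False
    then show ?thesis using S[of "?\<rho> \<theta>"] unfolding sq by (simp add: field_simps)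
  qed
  have S_bound: "\<bar>S (x\<^sup>2)\<bar> \<le> 1" for x
  proof (cases "x = 0")
    case False
    have "\<bar>x\<bar> * \<bar>S (x\<^sup>2)\<bar> \<le> \<bar>x\<bar> * 1"
      using abs_sin_x_le_abs_x[of x] by (simp flip: S add: abs_mult)
    then show ?thesis using False by (simp add: mult_le_cancel_left)
  qed (simp add: S0)
  have S'_bound: "\<bar>2 * x\<^sup>2 * S' (x\<^sup>2)\<bar> \<le> 2" for x
  proof -
    have "((\<lambda>x. x * S (x\<^sup>2)) has_real_derivative (1 * S (x\<^sup>2) + S' (x\<^sup>2) * (2 * x) * x)) (at x)"
      by (rule DERIV_mult[OF DERIV_ident DERIV_chain2[OF S']]) (auto intro!: derivative_eq_intros)
    moreover have "((\<lambda>x. x * S (x\<^sup>2)) has_real_derivative (cos x)) (at x)"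
      unfolding S by (auto intro!: derivative_eq_intros)
    ultimately have "1 * S (x\<^sup>2) + S' (x\<^sup>2) * (2 * x) * x = cos x" by (rule DERIV_unique)
    then have "2 * x\<^sup>2 * S' (x\<^sup>2) = cos x - S (x\<^sup>2)" by (simp add: power2_eq_square mult_ac)
    then show ?thesis using S_bound[of x] abs_cos_le_one[of x] by linarith
  qed
  \<comment> \<open>The bound is weakened to 3 because \<open>bounded_C1\<close> uses one constant
    for the function and its derivatives.\<close>
  have Q_bound: "\<bar>S (\<Sum>a\<in>A. (\<theta> a)\<^sup>2) * \<theta> m\<bar> \<le> 3" for \<theta>
  proof -
    have "\<bar>S ((?\<rho> \<theta>)\<^sup>2) * \<theta> m\<bar> \<le> \<bar>S ((?\<rho> \<theta>)\<^sup>2)\<bar> * \<bar>?\<rho> \<theta>\<bar>"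
      unfolding abs_mult using le[OF m, of \<theta>] by (intro mult_left_mono) auto
    also have "\<dots> = \<bar>sin (?\<rho> \<theta>)\<bar>" by (simp only: flip: S) (simp add: abs_mult)
    also have "\<dots> \<le> 3" using abs_sin_le_one[of "?\<rho> \<theta>"] by linarith
    finally show ?thesis unfolding sq .
  qed
  have D_bound: "\<bar>?D k \<theta>\<bar> \<le> 3" if "k \<in> A" for k \<theta>
  proof -
    have "\<bar>2 * \<theta> k * S' ((?\<rho> \<theta>)\<^sup>2) * \<theta> m\<bar> = 2 * (\<bar>\<theta> k\<bar> * \<bar>\<theta> m\<bar>) * \<bar>S' ((?\<rho> \<theta>)\<^sup>2)\<bar>"
      by (simp add: abs_mult mult_ac)
    also have "\<dots> \<le> 2 * (?\<rho> \<theta> * ?\<rho> \<theta>) * \<bar>S' ((?\<rho> \<theta>)\<^sup>2)\<bar>"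
      by (intro mult_right_mono mult_left_mono mult_mono le that m) (auto simp: sum_nonneg)
    also have "\<dots> = \<bar>2 * (?\<rho> \<theta>)\<^sup>2 * S' ((?\<rho> \<theta>)\<^sup>2)\<bar>"
      by (simp add: abs_mult power2_eq_square sum_nonneg)
    also have "\<dots> \<le> 2" by (rule S'_bound)
    finally show ?thesis using S_bound[of "?\<rho> \<theta>"] unfolding sq by (auto split: if_splits)
  qed
  have "bounded_C1 A (\<lambda>\<theta>. sin (?\<rho> \<theta>) / ?\<rho> \<theta> * \<theta> m) ?D 3"
    unfolding bounded_C1_def eq
  proof (intro conjI ballI allI impI)
    fix \<phi> \<phi>' and x :: real
    assume \<phi>: "\<forall>k\<in>A. (\<phi> k has_real_derivative \<phi>' k) (at x)"
    let ?s = "\<Sum>a\<in>A. (\<phi> a x)\<^sup>2"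
    have "((\<lambda>y. S (\<Sum>a\<in>A. (\<phi> a y)\<^sup>2) * \<phi> m y) has_real_derivative
        ((\<Sum>k\<in>A. (2 * \<phi> k x * S' ?s) * \<phi>' k) * \<phi> m x + \<phi>' m * S ?s)) (at x)"
      by (rule DERIV_mult[OF DERIV_comp_sum_squares[OF A S']]) (use \<phi> m in auto)
    also have "(\<Sum>k\<in>A. (2 * \<phi> k x * S' ?s) * \<phi>' k) * \<phi> m x + \<phi>' m * S ?s
        = (\<Sum>k\<in>A. (2 * \<phi> k x * S' ?s * \<phi> m x) * \<phi>' k) + (\<Sum>k\<in>A. if k = m then S ?s * \<phi>' k else 0)"
      using A m by (simp add: sum_distrib_left sum_distrib_right mult_ac)
    also have "\<dots> = (\<Sum>k\<in>A. (2 * \<phi> k x * S' ?s * \<phi> m x + (if k = m then S ?s else 0)) * \<phi>' k)"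
      by (subst sum.distrib[symmetric]) (auto simp: algebra_simps intro!: sum.cong)
    finally show "((\<lambda>y. S (\<Sum>a\<in>A. (\<phi> a y)\<^sup>2) * \<phi> m y) has_real_derivative \<dots>) (at x)" .
  qed (use Q_bound D_bound in auto)
  then show ?thesis by blast
qed

section \<open>The two kernels\<close>

text \<open>For 1 \<le> m \<le> K these are the coordinates of a point of the unit sphere with
  angles \<open>\<phi> 2\<close>, ..., \<open>\<phi> K\<close>; \<open>\<phi> 1\<close> is reserved
  for the signed radius.\<close>

definition spherical_unit :: "nat \<Rightarrow> nat \<Rightarrow> cd \<Rightarrow> real" where
  "spherical_unit K m \<phi> =
     (if m < K then (\<Prod>l=2..m. sin (\<phi> l)) * cos (\<phi> (m + 1)) else \<Prod>l=2..K. sin (\<phi> l))"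

text \<open>When \<open>K\<close> grows by one, the last coordinate P is replaced by P cos y and P
  sin y, which preserves the sum of squares. The induction keeps the last term separate because the
  coordinate of index \<open>K\<close> changes its form with \<open>K\<close>.\<close>

lemma sum_spherical_unit_squares:
  assumes "1 \<le> K"
  shows "(\<Sum>m\<in>{1..K}. (spherical_unit K m \<phi>)\<^sup>2) = 1"
proof -
  have "(\<Sum>m\<in>{1..<K}. ((\<Prod>l=2..m. sin (\<phi> l)) * cos (\<phi> (m + 1)))\<^sup>2) + (\<Prod>l=2..K. sin (\<phi> l))\<^sup>2 = 1"
    using assms
  proof (induction K rule: dec_induct)
    case (step K)
    have "(\<Prod>l=2..Suc K. sin (\<phi> l)) = (\<Prod>l=2..K. sin (\<phi> l)) * sin (\<phi> (Suc K))"
      using step.hyps by (simp add: prod.nat_ivl_Suc')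
    moreover have "(P * cos y)\<^sup>2 + (P * sin y)\<^sup>2 = P\<^sup>2" for P y :: real
      unfolding power_mult_distrib by (simp flip: distrib_left)
    ultimately show ?case using step by (simp add: add.assoc)
  qed simp
  moreover have "{1..K} = insert K {1..<K}" using assms by auto
  ultimately show ?thesis by (simp add: spherical_unit_def)
qed

lemma spherical_kernel_eq:
  fixes r n p t \<zeta>
  defines "\<phi> \<equiv> \<lambda>k. p k * tail_sum n t k + \<zeta> k"
  assumes "1 \<le> r" "i < 2 ^ r"
  shows "spherical_kernel r n p t \<zeta> i =
    (if i = 0 then p 0 * tail_sum n t 1 + \<zeta> 0 else \<phi> 1 * spherical_unit (2 ^ r - 1) i \<phi>)"
proof -
  let ?K = "2 ^ r - 1 :: nat"
  have "2 ^ 1 \<le> (2 ^ r :: nat)" using assms(2) by (intro power_increasing) auto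
  then have K: "1 \<le> ?K" by simp
  have "(\<Sum>m=1..?K-1. (\<Prod>l=2..m. sin (\<phi> l)) * cos (\<phi> (m + 1)) * cd_basis m i)
      = (\<Sum>m=1..?K-1. if m = i then (\<Prod>l=2..m. sin (\<phi> l)) * cos (\<phi> (m + 1)) else 0)"
    by (intro sum.cong) (auto simp: cd_basis_def)
  also have "\<dots> = (if i \<in> {1..?K-1} then (\<Prod>l=2..i. sin (\<phi> l)) * cos (\<phi> (i + 1)) else 0)"
    by simp
  finally show ?thesis
    using K assms(3) unfolding spherical_kernel_def Let_def \<phi>_def[symmetric]
    by (auto simp: spherical_unit_def cd_basis_def)
qed

text \<open>The norm supplies |x| where the kernel carries a signed radius; oddness of sine
  reconciles the two. At x = 0 both sides are 0.\<close>

lemma sin_abs_div_abs_mult: "sin \<bar>x\<bar> / \<bar>x\<bar> * (x * y) = sin x * (y :: real)"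
  by (cases "x = 0") (auto simp: abs_if)

text \<open>The imaginary part of the kernel is \<open>\<phi> 1\<close> times a unit vector, so its
  norm is |\<open>\<phi> 1\<close>| and the radius cancels against the denominator of the normalised
  sine.\<close>

lemma cd_exp_spherical_kernel:
  fixes r n p t \<zeta>
  defines "\<phi> \<equiv> \<lambda>k. p k * tail_sum n t k + \<zeta> k"
  assumes "1 \<le> r" "b < 2 ^ r"
  shows "cd_exp r (\<lambda>i. - spherical_kernel r n p t \<zeta> i) b = exp (- (p 0 * tail_sum n t 1 + \<zeta> 0)) *
    (if b = 0 then cos (\<phi> 1) else - (sin (\<phi> 1) * spherical_unit (2 ^ r - 1) b \<phi>))"
proof -
  have "2 ^ 1 \<le> (2 ^ r :: nat)" using assms(2) by (intro power_increasing) auto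
  then have K: "1 \<le> (2 ^ r - 1 :: nat)" by simp
  have u: "spherical_kernel r n p t \<zeta> i = (if i = 0 then p 0 * tail_sum n t 1 + \<zeta> 0
      else \<phi> 1 * spherical_unit (2 ^ r - 1) i \<phi>)" if "i < 2 ^ r" for i
    unfolding \<phi>_def by (rule spherical_kernel_eq) (use assms that in auto)
  have "(\<Sum>a\<in>{1..<2 ^ r}. (- spherical_kernel r n p t \<zeta> a)\<^sup>2)
      = (\<Sum>a\<in>{1..2 ^ r - 1}. (\<phi> 1)\<^sup>2 * (spherical_unit (2 ^ r - 1) a \<phi>)\<^sup>2)"
    by (intro sum.cong) (auto simp: u power_mult_distrib)
  also have "\<dots> = (\<phi> 1)\<^sup>2"
    unfolding sum_distrib_left[symmetric] sum_spherical_unit_squares[OF K] by simp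
  finally have \<rho>: "sqrt (\<Sum>a\<in>{1..<2 ^ r}. (- spherical_kernel r n p t \<zeta> a)\<^sup>2) = \<bar>\<phi> 1\<bar>"
    by simp
  show ?thesis
    unfolding cd_exp_eq[OF assms(3)] \<rho>
    using u[of 0] u[OF assms(3)] sin_abs_div_abs_mult[of "\<phi> 1"] by simp
qed

lemma cartesian_kernel_eq:
  "cartesian_kernel n p t \<zeta> i = (if i = 0 then p 0 * tail_sum n t 1 + \<zeta> 0
    else p i * (if i \<in> {1..n} then t i else 0) + \<zeta> i)"
proof -
  have "(\<Sum>k=1..n. p k * t k * cd_basis k i) = (\<Sum>k=1..n. if k = i then p k * t k else 0)"
    by (intro sum.cong) (auto simp: cd_basis_def)
  also have "\<dots> = (if i \<in> {1..n} then p i * t i else 0)"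
    by simp
  finally show ?thesis
    unfolding cartesian_kernel_def by (auto simp: cd_basis_def tail_sum_def)
qed

lemma cd_exp_cartesian_kernel:
  fixes r n p t \<zeta>
  defines "\<phi> \<equiv> \<lambda>k. p k * (if k \<in> {1..n} then t k else 0) + \<zeta> k"
  defines "\<rho> \<equiv> sqrt (\<Sum>a\<in>{1..<2 ^ r}. (\<phi> a)\<^sup>2)"
  assumes "b < 2 ^ r"
  shows "cd_exp r (\<lambda>i. - cartesian_kernel n p t \<zeta> i) b = exp (- (p 0 * tail_sum n t 1 + \<zeta> 0)) *
    (if b = 0 then cos \<rho> else - (sin \<rho> / \<rho> * \<phi> b))"
proof -
  have u: "cartesian_kernel n p t \<zeta> i = (if i = 0 then p 0 * tail_sum n t 1 + \<zeta> 0 else \<phi> i)" for i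
    unfolding cartesian_kernel_eq \<phi>_def ..
  have "(\<Sum>a\<in>{1..<2 ^ r}. (- cartesian_kernel n p t \<zeta> a)\<^sup>2) = (\<Sum>a\<in>{1..<2 ^ r}. (\<phi> a)\<^sup>2)"
    by (intro sum.cong) (auto simp: u)
  then show ?thesis
    unfolding cd_exp_eq[OF assms(3)] \<rho>_def by (simp add: u)
qed

lemma bounded_C1_spherical:
  assumes "1 \<le> K" "m \<le> K"
  shows "\<exists>D B. bounded_C1 {1..K}
    (\<lambda>\<theta>. if m = 0 then cos (\<theta> 1) else - (sin (\<theta> 1) * spherical_unit K m \<theta>)) D B"
proof (cases "m = 0")
  case True
  then show ?thesis using bounded_C1_cos[of "{1..K}" 1] assms by simp
next
  case False
  have "\<exists>D B. bounded_C1 {1..K} (spherical_unit K m) D B"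
  proof (cases "m < K")
    case True
    have "spherical_unit K m = (\<lambda>\<theta>. (\<Prod>l=2..m. sin (\<theta> l)) * cos (\<theta> (m + 1)))"
      using True by (auto simp: spherical_unit_def)
    then show ?thesis using True
      by (auto intro!: bounded_C1_mult_ex bounded_C1_prod bounded_C1_sin bounded_C1_cos)
  next
    case False
    then have "spherical_unit K m = (\<lambda>\<theta>. \<Prod>l=2..K. sin (\<theta> l))"
      by (auto simp: spherical_unit_def)
    then show ?thesis by (auto intro!: bounded_C1_prod bounded_C1_sin)
  qed
  then have "\<exists>D B. bounded_C1 {1..K} (\<lambda>\<theta>. - (sin (\<theta> 1) * spherical_unit K m \<theta>)) D B"
    using assms by (intro bounded_C1_uminus_ex bounded_C1_mult_ex bounded_C1_sin) auto
  then show ?thesis using False by simp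
qed

lemma bounded_C1_cartesian:
  fixes K :: nat
  assumes "m \<le> K"
  defines "\<rho> \<equiv> \<lambda>\<theta>::cd. sqrt (\<Sum>a\<in>{1..K}. (\<theta> a)\<^sup>2)"
  shows "\<exists>D B. bounded_C1 {1..K} (\<lambda>\<theta>. if m = 0 then cos (\<rho> \<theta>) else - (sin (\<rho> \<theta>) / \<rho> \<theta> * \<theta> m)) D B"
proof (cases "m = 0")
  case True
  then show ?thesis unfolding \<rho>_def using bounded_C1_cos_norm[of "{1..K}"] by simp
next
  case False
  then show ?thesis
    unfolding \<rho>_def using bounded_C1_uminus_ex[OF bounded_C1_sinc_norm[of "{1..K}" m]] assms(1) by simp
qed

section \<open>Integration over the orthant\<close>

interpretation lborel_PiM: product_sigma_finite "\<lambda>_::nat. lborel :: real measure"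
  by standard

lemma space_lebesgue_on_coords: "space (lebesgue_on_coords {1..n}) = Rn n"
  by (simp add: lebesgue_on_coords_def space_PiM Rn_def)

text \<open>Coordinates outside \<open>I\<close> are constantly \<open>undefined\<close> on the
  space of the product measure. Hence Borel functions of a whole sequence may be integrated over the
  coordinates in \<open>I\<close>.\<close>

lemma measurable_PiM_borel_fun:
  "(\<lambda>t. t) \<in> borel_measurable (PiM I (\<lambda>_::nat. lborel :: real measure))"
proof (rule measurable_coordinatewise_then_product)
  fix i
  show "(\<lambda>t. t i) \<in> borel_measurable (PiM I (\<lambda>_. lborel :: real measure))"
  proof (cases "i \<in> I")
    case True
    then show ?thesis using measurable_component_singleton[OF True, of "\<lambda>_. lborel :: real measure"] by simp
  next
    case False
    have "(\<lambda>t. t i) \<in> borel_measurable (PiM I (\<lambda>_. lborel :: real measure)) \<longleftrightarrow>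
        (\<lambda>t. undefined :: real) \<in> borel_measurable (PiM I (\<lambda>_. lborel :: real measure))"
      by (rule measurable_cong) (use False in \<open>simp add: space_PiM PiE_def extensional_def\<close>)
    then show ?thesis by simp
  qed
qed

lemma borel_measurable_lebesgue_on_coords:
  "f \<in> borel_measurable borel \<Longrightarrow> f \<in> borel_measurable (lebesgue_on_coords I)"
  unfolding lebesgue_on_coords_def
  by (rule measurable_completion, rule measurable_compose[OF measurable_PiM_borel_fun])

text \<open>The preimage of an open set is a relatively open set together with some points of
  discontinuity. The latter lie in a null set and are measurable because the measure is
  complete.\<close>

lemma AE_continuous_imp_measurable:
  fixes f :: "(nat \<Rightarrow> real) \<Rightarrow> real"
  assumes "AE t in lebesgue_on_coords {1..n}. continuous (at t within Rn n) f"
  shows "f \<in> borel_measurable (lebesgue_on_coords {1..n})"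
proof (rule borel_measurableI)
  fix V :: "real set" assume V: "open V"
  let ?M = "lebesgue_on_coords {1..n}"
  obtain N where N: "N \<in> null_sets ?M" "{t \<in> space ?M. \<not> continuous (at t within Rn n) f} \<subseteq> N"
    using assms by (auto simp: eventually_ae_filter)
  define G where "G = \<Union>{U. open U \<and> (\<forall>t\<in>U \<inter> Rn n. f t \<in> V)}"
  have "open G" unfolding G_def by auto
  then have "G \<inter> Rn n \<in> sets ?M"
    using measurable_sets[OF borel_measurable_lebesgue_on_coords[of "\<lambda>t. t"], of G "{1..n}"]
    by (simp add: space_lebesgue_on_coords del: One_nat_def)
  moreover have "f -` V \<inter> Rn n - G \<subseteq> N"
  proof
    fix t assume t: "t \<in> f -` V \<inter> Rn n - G"
    have "\<not> continuous (at t within Rn n) f"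
    proof
      assume "continuous (at t within Rn n) f"
      then obtain A where "open A" "t \<in> A" "\<forall>y\<in>Rn n. y \<in> A \<longrightarrow> f y \<in> V"
        using V t unfolding continuous_within_topological by blast
      then have "t \<in> G" unfolding G_def by blast
      then show False using t by simp
    qed
    then show "t \<in> N" using N(2) t unfolding space_lebesgue_on_coords by auto
  qed
  then have "f -` V \<inter> Rn n - G \<in> sets ?M"
    using N(1) completion.complete unfolding lebesgue_on_coords_def by blast
  moreover have "f -` V \<inter> space ?M = (G \<inter> Rn n) \<union> (f -` V \<inter> Rn n - G)"
    unfolding space_lebesgue_on_coords G_def by blast
  ultimately show "f -` V \<inter> space ?M \<in> sets ?M" by simp
qed

section \<open>Exponential majorants on the orthant\<close>

lemma indicator_orthant_eq_prod:
  "t \<in> Rn n \<Longrightarrow> indicator (orthant n) t * exp (c * tail_sum n t 1)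
    = (\<Prod>k\<in>{1..n}. indicator {0..} (t k) * exp (c * t k :: real))"
proof -
  assume t: "t \<in> Rn n"
  show ?thesis
  proof (cases "t \<in> orthant n")
    case True
    then have "(\<Prod>k\<in>{1..n}. indicator {0..} (t k) * exp (c * t k :: real)) = (\<Prod>k\<in>{1..n}. exp (c * t k))"
      by (intro prod.cong) (auto simp: orthant_def)
    then show ?thesis using True by (simp add: exp_sum tail_sum_def sum_distrib_left)
  next
    case False
    then obtain k where "k \<in> {1..n}" "t k < 0" using t by (auto simp: orthant_def not_le)
    then have "(\<Prod>k\<in>{1..n}. indicator {0..} (t k) * exp (c * t k :: real)) = 0"
      by (intro prod_zero) (auto intro!: bexI[of _ k])
    then show ?thesis using False by simp
  qed
qed

text \<open>The function is a product of integrable functions of one variable each, by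
  \<open>indicator_orthant_eq_prod\<close>.\<close>

lemma integrable_exp_orthant:
  assumes "c < 0"
  shows "integrable (lebesgue_on_coords {1..n})
    (\<lambda>t. indicator (orthant n) t * exp (c * tail_sum n t 1))"
proof -
  have "(\<lambda>x. exp (c * x)) integrable_on {0..}"
    using integrable_on_exp_minus_to_infinity[of "- c" 0] assms by simp
  then have "set_integrable lebesgue {0..} (\<lambda>x. exp (c * x))"
    by (intro nonnegative_absolutely_integrable_1) auto
  then have "integrable lborel (\<lambda>x. indicator {0..} x * exp (c * x) :: real)"
    by (simp add: set_integrable_def integrable_completion)
  then have "integrable (PiM {1..n} (\<lambda>_. lborel))
      (\<lambda>t. \<Prod>k\<in>{1..n}. indicator {0..} (t k) * exp (c * t k) :: real)"
    by (intro lborel_PiM.product_integrable_prod) auto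
  then have "integrable (lebesgue_on_coords {1..n})
      (\<lambda>t. \<Prod>k\<in>{1..n}. indicator {0..} (t k) * exp (c * t k) :: real)"
    unfolding lebesgue_on_coords_def by (subst integrable_completion) auto
  then show ?thesis
    by (rule Bochner_Integration.integrable_cong[THEN iffD1, rotated 2])
       (auto simp: space_lebesgue_on_coords indicator_orthant_eq_prod simp del: One_nat_def)
qed

lemma integrable_orthant_bound:
  assumes "h \<in> borel_measurable (lebesgue_on_coords {1..n})" "c < 0"
    and "\<And>t. t \<in> orthant n \<Longrightarrow> \<bar>h t\<bar> \<le> C * exp (c * tail_sum n t 1)"
    and "\<And>t. t \<in> Rn n \<Longrightarrow> t \<notin> orthant n \<Longrightarrow> h t = 0"
  shows "integrable (lebesgue_on_coords {1..n}) h"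
proof (rule Bochner_Integration.integrable_bound)
  show "integrable (lebesgue_on_coords {1..n})
      (\<lambda>t. C * (indicator (orthant n) t * exp (c * tail_sum n t 1)))"
    by (intro integrable_mult_right integrable_exp_orthant assms)
  show "AE t in lebesgue_on_coords {1..n}.
      norm (h t) \<le> norm (C * (indicator (orthant n) t * exp (c * tail_sum n t 1)))"
  proof (rule AE_I2)
    fix t assume "t \<in> space (lebesgue_on_coords {1..n})"
    then have t: "t \<in> Rn n" unfolding space_lebesgue_on_coords .
    show "norm (h t) \<le> norm (C * (indicator (orthant n) t * exp (c * tail_sum n t 1)))"
    proof (cases "t \<in> orthant n")
      case True
      then show ?thesis using assms(3)[OF True] by simp
    qed (simp add: assms(4)[OF t])
  qed
qed (rule assms)

text \<open>The fundamental theorem on [0, m], followed by dominated convergence as m tends to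
  infinity. \<open>H\<close> agrees with the derivative only almost everywhere because it will be a
  Borel representative of the integrand.\<close>

lemma FTC_half_line:
  fixes G G' H :: "real \<Rightarrow> real"
  assumes H: "integrable lborel H"
    and ae: "AE x in lborel. H x = indicator {0..} x * G' x"
    and deriv: "\<And>x. 0 \<le> x \<Longrightarrow> (G has_real_derivative G' x) (at x within {0..})"
    and lim: "(G \<longlongrightarrow> 0) at_top"
  shows "(LINT x|lborel. H x) = - G 0"
proof -
  obtain N where N: "N \<in> null_sets lborel" "\<And>x. x \<notin> N \<Longrightarrow> H x = indicator {0..} x * G' x"
    using ae by (auto simp: eventually_ae_filter)
  have "negligible N"
    using null_sets_completionI[OF N(1)] by (simp add: negligible_iff_null_sets)
  have part: "(LINT x|lborel. indicator {0..real m} x * H x) = G (real m) - G 0" for m :: nat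
  proof -
    \<comment> \<open>The gauge integral recovers \<open>G\<close> from its derivative without
      continuity of \<open>G'\<close>.\<close>
    have "(G' has_integral (G (real m) - G 0)) {0..real m}"
    proof (rule fundamental_theorem_of_calculus)
      fix x assume "x \<in> {0..real m}"
      then show "(G has_vector_derivative G' x) (at x within {0..real m})"
        by (auto simp flip: has_real_derivative_iff_has_vector_derivative
            intro: has_field_derivative_subset[OF deriv])
    qed simp
    then have "(H has_integral (G (real m) - G 0)) {0..real m}"
      by (rule has_integral_spike[OF \<open>negligible N\<close>, rotated]) (auto simp: N(2))
    \<comment> \<open>Integrability of \<open>H\<close> turns the gauge integral into a Lebesgue
      integral.\<close>
    moreover have "set_integrable lborel {0..real m} H"
      unfolding set_integrable_def using integrable_mult_indicator[OF _ H] by simp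
    ultimately show ?thesis
      using set_borel_integral_eq_integral(2)[of "{0..real m}" H]
      by (simp add: set_lebesgue_integral_def integral_unique)
  qed
  have "(\<lambda>m. LINT x|lborel. indicator {0..real m} x * H x) \<longlonglongrightarrow> (LINT x|lborel. H x)"
  proof (rule integral_dominated_convergence[where w = "\<lambda>x. \<bar>H x\<bar>"])
    show "AE x in lborel. (\<lambda>m. indicator {0..real m} x * H x) \<longlonglongrightarrow> H x"
      using ae
    proof eventually_elim
      fix x assume x: "H x = indicator {0..} x * G' x"
      obtain m0 where "x \<le> real m0" using real_arch_simple by blast
      then have "\<forall>m\<ge>m0. indicator {0..real m} x * H x = H x"
        by (auto simp: x indicator_def)
      then show "(\<lambda>m. indicator {0..real m} x * H x) \<longlonglongrightarrow> H x"
        by (intro tendsto_eventually) (auto simp: eventually_sequentially)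
    qed
  qed (use H in \<open>auto simp: indicator_def\<close>)
  moreover have "(\<lambda>m. G (real m) - G 0) \<longlonglongrightarrow> 0 - G 0"
    by (intro tendsto_diff filterlim_compose[OF lim filterlim_real_sequentially] tendsto_const)
  ultimately show ?thesis
    unfolding part by (auto dest: LIMSEQ_unique)
qed

text \<open>Both measures give a set the iterated integral of its indicator. This transports
  Fubini's theorem from pairs to the splitting off of one coordinate.\<close>

lemma PiM_insert_eq_distr:
  fixes I :: "nat set"
  assumes "finite I" "j \<notin> I"
  shows "PiM (insert j I) (\<lambda>_. lborel :: real measure)
    = distr (PiM I (\<lambda>_. lborel) \<Otimes>\<^sub>M lborel) (PiM (insert j I) (\<lambda>_. lborel)) (\<lambda>(t, x). t(j := x))"
    (is "?M = distr ?P ?M ?upd")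
proof (rule measure_eqI)
  interpret I: finite_product_sigma_finite "\<lambda>_. lborel :: real measure" I by standard fact
  have [measurable]: "?upd \<in> measurable ?P ?M"
    by (rule measurable_add_dim)
  show "emeasure ?M A = emeasure (distr ?P ?M ?upd) A" if "A \<in> sets ?M" for A
  proof -
    note that[measurable]
    have "emeasure (distr ?P ?M ?upd) A = (\<integral>\<^sup>+ y. indicator A y \<partial>distr ?P ?M ?upd)"
      by simp
    also have "\<dots> = (\<integral>\<^sup>+ z. indicator A (?upd z) \<partial>?P)"
      by (rule nn_integral_distr) auto
    also have "\<dots> = (\<integral>\<^sup>+ t. \<integral>\<^sup>+ x. indicator A (?upd (t, x)) \<partial>lborel \<partial>PiM I (\<lambda>_. lborel))"
      by (rule lborel.nn_integral_fst[symmetric]) auto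
    also have "\<dots> = (\<integral>\<^sup>+ y. indicator A y \<partial>?M)"
      using assms by (subst lborel_PiM.product_nn_integral_insert) auto
    finally show ?thesis by simp
  qed
qed simp

text \<open>Preimages under \<open>f\<close> and \<open>g\<close> differ only inside a null set, all
  of whose subsets are measurable in the completion.\<close>

lemma borel_measurable_completion_AE:
  assumes g: "g \<in> borel_measurable (completion M)" and ae: "AE x in completion M. g x = f x"
  shows "f \<in> borel_measurable (completion M)"
proof (rule borel_measurableI)
  fix V :: "'b set" assume "open V"
  obtain N where N: "N \<in> null_sets (completion M)" "{x \<in> space (completion M). g x \<noteq> f x} \<subseteq> N"
    using ae by (auto simp: eventually_ae_filter)
  have "f -` V \<inter> space (completion M) =
      (g -` V \<inter> space (completion M) - N) \<union> (f -` V \<inter> space (completion M) \<inter> N)"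
    using N(2) by auto
  also have "\<dots> \<in> sets (completion M)"
  proof (rule sets.Un)
    show "g -` V \<inter> space (completion M) - N \<in> sets (completion M)"
      using measurable_sets[OF g borel_open[OF \<open>open V\<close>]] null_setsD2[OF N(1)] by (rule sets.Diff)
    show "f -` V \<inter> space (completion M) \<inter> N \<in> sets (completion M)"
      by (rule completion.complete[OF _ N(1)]) blast
  qed
  finally show "f -` V \<inter> space (completion M) \<in> sets (completion M)" .
qed

text \<open>The integral over the orthant is computed along the \<open>j\<close>-th axis first. The function on the
  face is not assumed measurable: by Fubini's theorem it agrees almost everywhere with a partial
  integral.\<close>

lemma integral_partial_derivative_orthant:
  fixes G G' :: "(nat \<Rightarrow> real) \<Rightarrow> real"
  assumes j: "j \<in> {1..n}"
    and int: "integrable (lebesgue_on_coords {1..n}) (\<lambda>t. indicator (orthant n) t * G' t)"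
    and deriv: "\<And>t. t \<in> orthant n \<Longrightarrow>
      ((\<lambda>x. G (t(j := x))) has_real_derivative G' t) (at (t j) within {0..})"
    and lim: "\<And>t. t \<in> orthant n \<Longrightarrow> ((\<lambda>x. G (t(j := x))) \<longlongrightarrow> 0) at_top"
  shows "integrable (lebesgue_on_coords ({1..n} - {j}))
      (\<lambda>t. indicator (orthant n) (t(j := 0)) * G (t(j := 0)))"
    and "(LINT t|lebesgue_on_coords {1..n}. indicator (orthant n) t * G' t)
      = - (LINT t|lebesgue_on_coords ({1..n} - {j}). indicator (orthant n) (t(j := 0)) * G (t(j := 0)))"
proof -
  let ?h = "\<lambda>t. indicator (orthant n) t * G' t"
  let ?I = "{1..n} - {j}"
  let ?M = "PiM {1..n} (\<lambda>_. lborel :: real measure)" and ?MI = "PiM ?I (\<lambda>_. lborel :: real measure)"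
  let ?upd = "\<lambda>(t, x). t(j := x)"
  let ?face = "\<lambda>t. indicator (orthant n) (t(j := 0)) * G (t(j := 0))"
  have ins: "insert j ?I = {1..n}" using j by auto
  have M: "?M = distr (?MI \<Otimes>\<^sub>M lborel) ?M ?upd"
    using PiM_insert_eq_distr[of ?I j] unfolding ins by simp
  have upd[measurable]: "?upd \<in> measurable (?MI \<Otimes>\<^sub>M lborel) ?M"
    using measurable_add_dim[of j ?I "\<lambda>_. lborel"] unfolding ins .
  interpret I: finite_product_sigma_finite "\<lambda>_. lborel :: real measure" ?I by standard simp
  interpret P: pair_sigma_finite ?MI lborel ..
  \<comment> \<open>Fubini's theorem applies to the uncompleted product measure, so the integrand is
    replaced by a Borel function that agrees with it almost everywhere.\<close>
  obtain H where H[measurable]: "H \<in> borel_measurable ?M" and hH: "AE t in ?M. ?h t = H t"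
    using completion_ex_borel_measurable_real[OF borel_measurable_integrable[OF int[unfolded lebesgue_on_coords_def]]]
    by blast
  have "integrable (completion ?M) H"
    using int hH unfolding lebesgue_on_coords_def
    by (subst integrable_cong_AE[of _ _ ?h]) (auto intro: AE_completion measurable_completion[OF H] simp del: One_nat_def)
  then have "integrable ?M H" by (rule integrable_completion[OF H, THEN iffD1])
  then have "integrable (distr (?MI \<Otimes>\<^sub>M lborel) ?M ?upd) H" unfolding M[symmetric] .
  then have P_int: "integrable (?MI \<Otimes>\<^sub>M lborel) (\<lambda>z. H (?upd z))"
    by (rule integrable_distr[OF upd])
  have "AE t in distr (?MI \<Otimes>\<^sub>M lborel) ?M ?upd. ?h t = H t"
    using hH unfolding M[symmetric] .
  from AE_distrD[OF upd this] have "AE t in ?MI. AE x in lborel. ?h (t(j := x)) = H (t(j := x))"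
    using P.AE_pair by force
  moreover have "AE t in ?MI. integrable lborel (\<lambda>x. H (t(j := x)))"
    using P.AE_integrable_fst'[OF P_int] by simp
  ultimately have "AE t in ?MI. - (LINT x|lborel. H (t(j := x))) = ?face t"
    using AE_space
  proof eventually_elim
    fix t assume ae: "AE x in lborel. ?h (t(j := x)) = H (t(j := x))"
      and int_t: "integrable lborel (\<lambda>x. H (t(j := x)))" and t: "t \<in> space ?MI"
    \<comment> \<open>On a line parallel to the \<open>j\<close>-th axis the orthant is either the
      half-line x \<ge> 0 or empty, depending only on the foot of the line on the face.\<close>
    have orth: "t(j := x) \<in> orthant n \<longleftrightarrow> 0 \<le> x \<and> t(j := 0) \<in> orthant n" for x
      using t j by (auto simp: space_PiM orthant_def Rn_def PiE_iff extensional_def)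
    show "- (LINT x|lborel. H (t(j := x))) = ?face t"
    proof (cases "t(j := 0) \<in> orthant n")
      case True
      then have in_orthant: "t(j := x) \<in> orthant n \<longleftrightarrow> 0 \<le> x" for x
        using orth[of x] by blast
      have "(LINT x|lborel. H (t(j := x))) = - G (t(j := 0))"
      proof (rule FTC_half_line[OF int_t, where G' = "\<lambda>x. G' (t(j := x))"])
        show "AE x in lborel. H (t(j := x)) = indicator {0..} x * G' (t(j := x))"
          using ae by eventually_elim (auto simp: indicator_def in_orthant)
        show "((\<lambda>x. G (t(j := x))) has_real_derivative G' (t(j := x))) (at x within {0..})" if "0 \<le> x" for x
          using deriv[of "t(j := x)"] in_orthant that by simp
        show "((\<lambda>x. G (t(j := x))) \<longlongrightarrow> 0) at_top"
          using lim[OF True] by simp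
      qed
      then show ?thesis using True by simp
    next
      case False
      then have not_in_orthant: "t(j := x) \<notin> orthant n" for x
        using orth[of x] by blast
      have "AE x in lborel. H (t(j := x)) = 0"
        using ae by eventually_elim (simp add: not_in_orthant)
      then have "(LINT x|lborel. H (t(j := x))) = 0"
        by (rule integral_eq_zero_AE)
      then show ?thesis using False by simp
    qed
  qed
  then have ae: "AE t in completion ?MI. - (LINT x|lborel. H (t(j := x))) = ?face t"
    by (rule AE_completion)
  have inner: "integrable ?MI (\<lambda>t. - (LINT x|lborel. H (t(j := x))))"
    using P.integrable_fst'[OF P_int] by simp
  then have inner': "integrable (completion ?MI) (\<lambda>t. - (LINT x|lborel. H (t(j := x))))"
    by (subst integrable_completion) auto
  \<comment> \<open>The face function becomes measurable only here, through its almost everywhere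
    agreement with the inner integral.\<close>
  have meas: "?face \<in> borel_measurable (completion ?MI)"
    by (rule borel_measurable_completion_AE[OF borel_measurable_integrable[OF inner'] ae])
  show "integrable (lebesgue_on_coords ?I) ?face"
    using integrable_cong_AE[OF _ meas ae] inner' unfolding lebesgue_on_coords_def by blast
  have "(LINT t|completion ?MI. ?face t) = (LINT t|completion ?MI. - (LINT x|lborel. H (t(j := x))))"
    using inner' ae by (intro integral_cong_AE meas) auto
  also have "\<dots> = (LINT t|?MI. - (LINT x|lborel. H (t(j := x))))"
    using inner by (intro integral_completion) auto
  also have "\<dots> = - (LINT z|(?MI \<Otimes>\<^sub>M lborel). H (?upd z))"
    using P.integral_fst'[OF P_int] by simp
  also have "\<dots> = - (LINT t|distr (?MI \<Otimes>\<^sub>M lborel) ?M ?upd. H t)"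
    by (subst integral_distr[OF upd H]) (rule refl)
  also have "\<dots> = - (LINT t|?M. H t)"
    unfolding M[symmetric] ..
  also have "\<dots> = - (LINT t|completion ?M. H t)"
    by (subst integral_completion[OF H]) (rule refl)
  also have "(LINT t|completion ?M. H t) = (LINT t|completion ?M. ?h t)"
    using int hH unfolding lebesgue_on_coords_def
    by (intro integral_cong_AE) (auto intro: AE_completion measurable_completion[OF H] simp del: One_nat_def)
  finally show "(LINT t|lebesgue_on_coords {1..n}. ?h t) = - (LINT t|lebesgue_on_coords ?I. ?face t)"
    unfolding lebesgue_on_coords_def by linarith
qed

text \<open>Dominated convergence applied to difference quotients along an arbitrary null sequence;
  the mean value inequality bounds them all by \<open>w\<close>.\<close>

lemma DERIV_lebesgue_integral:
  fixes f f' :: "real \<Rightarrow> 'a \<Rightarrow> real"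
  assumes f: "\<And>x. integrable M (f x)"
    and f': "\<And>x t. t \<in> space M \<Longrightarrow> ((\<lambda>y. f y t) has_real_derivative f' x t) (at x)"
    and meas: "f' x0 \<in> borel_measurable M"
    and w: "integrable M w" "\<And>x t. t \<in> space M \<Longrightarrow> \<bar>f' x t\<bar> \<le> w t"
  shows "((\<lambda>x. LINT t|M. f x t) has_real_derivative (LINT t|M. f' x0 t)) (at x0)"
  unfolding DERIV_def tendsto_at_iff_sequentially
proof (intro allI impI)
  fix X :: "nat \<Rightarrow> real" assume X: "\<forall>i. X i \<in> UNIV - {0}" "X \<longlonglongrightarrow> 0"
  have "(\<lambda>i. LINT t|M. (f (x0 + X i) t - f x0 t) / X i) \<longlonglongrightarrow> (LINT t|M. f' x0 t)"
  proof (rule integral_dominated_convergence[where w = w])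
    show "AE t in M. (\<lambda>i. (f (x0 + X i) t - f x0 t) / X i) \<longlonglongrightarrow> f' x0 t"
    proof (rule AE_I2)
      fix t assume "t \<in> space M"
      from f'[OF this, of x0] X show "(\<lambda>i. (f (x0 + X i) t - f x0 t) / X i) \<longlonglongrightarrow> f' x0 t"
        unfolding DERIV_def tendsto_at_iff_sequentially comp_def by blast
    qed
    show "AE t in M. norm ((f (x0 + X i) t - f x0 t) / X i) \<le> w t" for i
    proof (rule AE_I2)
      fix t assume t: "t \<in> space M"
      have "norm (f (x0 + X i) t - f x0 t) \<le> w t * norm (x0 + X i - x0)"
        by (rule field_differentiable_bound[where S = UNIV and f' = "\<lambda>x. f' x t"])
           (auto intro!: f' w t)
      moreover have "X i \<noteq> 0" using X(1) by auto
      ultimately show "norm ((f (x0 + X i) t - f x0 t) / X i) \<le> w t"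
        by (simp add: field_simps)
    qed
  qed (use meas w f in auto)
  then show "((\<lambda>h. ((LINT t|M. f (x0 + h) t) - (LINT t|M. f x0 t)) / h) \<circ> X) \<longlonglongrightarrow> (LINT t|M. f' x0 t)"
    using f by (simp add: comp_def)
qed

text \<open>The tail from \<open>k\<close> contains the \<open>j\<close>-th coordinate exactly when
  k \<le> j; this produces the range of summation in the spherical formula.\<close>

lemma tail_sum_upd:
  "j \<in> {1..n} \<Longrightarrow> tail_sum n (t(j := x)) k = tail_sum n (t(j := 0)) k + (if k \<le> j then x else 0)"
proof -
  assume j: "j \<in> {1..n}"
  have "tail_sum n (t(j := x)) k = (\<Sum>m=k..n. (t(j := 0)) m + (if m = j then x else 0))"
    unfolding tail_sum_def by (rule sum.cong) auto
  then show ?thesis using j by (simp add: sum.distrib tail_sum_def)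
qed

lemma tail_sum_upd_1: "j \<in> {1..n} \<Longrightarrow> \<exists>T. \<forall>x. tail_sum n (t(j := x)) 1 = T + x"
proof (intro exI allI)
  show "tail_sum n (t(j := x)) 1 = tail_sum n (t(j := 0)) 1 + x" if "j \<in> {1..n}" for x
    using tail_sum_upd[OF that, of t x 1] that by simp
qed

lemma tail_sum_measurable [measurable]: "(\<lambda>t. tail_sum n t k) \<in> borel_measurable borel"
  unfolding tail_sum_def by measurable

lemma exp_mult_collect:
  "(C * exp (a * s)) * (B * e * exp (- q * s)) = C * B * e * exp ((a - q) * s)" for s :: real
proof -
  have "exp ((a - q) * s) = exp (a * s) * exp (- q * s)"
    unfolding exp_add[symmetric] by (simp add: left_diff_distrib)
  then show ?thesis by simp
qed

section \<open>Transforms of real-valued originals\<close>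

text \<open>Common model of one scalar coordinate of exp (-u) for both kernels. \<open>J\<close>
  collects the indices of the \<sigma> k that grow at unit rate in the \<open>j\<close>-th variable:
  \<open>{1..j}\<close> in the spherical case, \<open>{j}\<close> in the Cartesian one.\<close>

locale orthant_kernel =
  fixes n j K :: nat and J :: "nat set" and \<sigma> :: "nat \<Rightarrow> (nat \<Rightarrow> real) \<Rightarrow> real"
    and p :: cd and Q :: "cd \<Rightarrow> real" and D :: "nat \<Rightarrow> cd \<Rightarrow> real" and B :: real
  assumes j: "j \<in> {1..n}" and J: "J \<subseteq> {1..K}"
    and \<sigma>_measurable [measurable]: "\<And>k. \<sigma> k \<in> borel_measurable borel"
    and \<sigma>_upd: "\<And>k t x. k \<in> {1..K} \<Longrightarrow>
      \<sigma> k (t(j := x)) = \<sigma> k (t(j := 0)) + (if k \<in> J then x else 0)"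
    and Q: "bounded_C1 {1..K} Q D B"
begin

definition phase :: "(nat \<Rightarrow> real) \<Rightarrow> cd \<Rightarrow> cd" where
  "phase t \<zeta> = (\<lambda>k. p k * \<sigma> k t + \<zeta> k)"

definition ker :: "(nat \<Rightarrow> real) \<Rightarrow> cd \<Rightarrow> real" where
  "ker t \<zeta> = exp (- (p 0 * tail_sum n t 1 + \<zeta> 0)) * Q (phase t \<zeta>)"

text \<open>For 1 \<le> k \<le> K this is the partial derivative of \<open>ker\<close> in \<zeta> k,
  not in a time variable.\<close>

definition dker :: "nat \<Rightarrow> (nat \<Rightarrow> real) \<Rightarrow> cd \<Rightarrow> real" where
  "dker k t \<zeta> = exp (- (p 0 * tail_sum n t 1 + \<zeta> 0)) * D k (phase t \<zeta>)"

lemma phase_measurable: "(\<lambda>t. phase t \<zeta>) \<in> borel_measurable borel"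
  unfolding phase_def by (rule measurable_coordinatewise_then_product) measurable

lemma ker_measurable: "(\<lambda>t. ker t \<zeta>) \<in> borel_measurable borel"
proof -
  have "(\<lambda>t. Q (phase t \<zeta>)) \<in> borel_measurable borel"
    using Q by (intro measurable_compose[OF phase_measurable]) (simp add: bounded_C1_def)
  then show ?thesis unfolding ker_def by measurable
qed

lemma dker_measurable:
  assumes "k \<in> {1..K}"
  shows "(\<lambda>t. dker k t \<zeta>) \<in> borel_measurable borel"
proof -
  have "(\<lambda>t. D k (phase t \<zeta>)) \<in> borel_measurable borel"
    using Q assms by (intro measurable_compose[OF phase_measurable]) (simp add: bounded_C1_def)
  then show ?thesis unfolding dker_def by measurable
qed

lemma
  shows abs_ker_le: "\<bar>ker t \<zeta>\<bar> \<le> B * exp (- \<zeta> 0) * exp (- p 0 * tail_sum n t 1)"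
    and abs_dker_le: "k \<in> {1..K} \<Longrightarrow>
      \<bar>dker k t \<zeta>\<bar> \<le> B * exp (- \<zeta> 0) * exp (- p 0 * tail_sum n t 1)"
proof -
  have eq: "exp (- (p 0 * tail_sum n t 1 + \<zeta> 0)) = exp (- \<zeta> 0) * exp (- p 0 * tail_sum n t 1)"
    by (simp flip: exp_add)
  have b: "\<bar>exp (- (p 0 * tail_sum n t 1 + \<zeta> 0)) * q\<bar>
      \<le> B * exp (- \<zeta> 0) * exp (- p 0 * tail_sum n t 1)" if "\<bar>q\<bar> \<le> B" for q
  proof -
    have "\<bar>exp (- (p 0 * tail_sum n t 1 + \<zeta> 0)) * q\<bar>
        = exp (- \<zeta> 0) * exp (- p 0 * tail_sum n t 1) * \<bar>q\<bar>"
      unfolding eq by (simp add: abs_mult)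
    also have "\<dots> \<le> exp (- \<zeta> 0) * exp (- p 0 * tail_sum n t 1) * B"
      by (intro mult_left_mono that) simp
    finally show ?thesis by (simp add: mult_ac)
  qed
  show "\<bar>ker t \<zeta>\<bar> \<le> B * exp (- \<zeta> 0) * exp (- p 0 * tail_sum n t 1)"
    unfolding ker_def using Q by (intro b) (simp add: bounded_C1_def)
  show "\<bar>dker k t \<zeta>\<bar> \<le> B * exp (- \<zeta> 0) * exp (- p 0 * tail_sum n t 1)" if "k \<in> {1..K}"
    unfolding dker_def using Q that by (intro b) (simp add: bounded_C1_def)
qed

lemma DERIV_Q:
  assumes "\<And>k. k \<in> {1..K} \<Longrightarrow> (\<phi> k has_real_derivative \<phi>' k) (at x)"
  shows "((\<lambda>y. Q (\<lambda>k. \<phi> k y)) has_real_derivative (\<Sum>k\<in>{1..K}. D k (\<lambda>k. \<phi> k x) * \<phi>' k)) (at x)"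
  using Q assms unfolding bounded_C1_def by blast

lemma DERIV_ker_shift:
  assumes k: "k \<in> {1..K}"
  shows "((\<lambda>x. ker t (\<zeta>(k := x))) has_real_derivative dker k t (\<zeta>(k := x))) (at x)"
proof -
  have "((\<lambda>y. Q (\<lambda>l. p l * \<sigma> l t + (\<zeta>(k := y)) l)) has_real_derivative
      (\<Sum>l\<in>{1..K}. D l (\<lambda>l. p l * \<sigma> l t + (\<zeta>(k := x)) l) * (if l = k then 1 else 0))) (at x)"
    by (rule DERIV_Q) (auto intro!: derivative_eq_intros)
  also have "(\<Sum>l\<in>{1..K}. D l (\<lambda>l. p l * \<sigma> l t + (\<zeta>(k := x)) l) * (if l = k then 1 else 0))
      = (\<Sum>l\<in>{1..K}. if l = k then D l (\<lambda>l. p l * \<sigma> l t + (\<zeta>(k := x)) l) else 0)"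
    by (rule sum.cong) auto
  also have "\<dots> = D k (phase t (\<zeta>(k := x)))"
    using k by (simp add: phase_def)
  finally have "((\<lambda>y. Q (phase t (\<zeta>(k := y)))) has_real_derivative D k (phase t (\<zeta>(k := x)))) (at x)"
    unfolding phase_def .
  \<comment> \<open>Since k \<ge> 1, moving \<zeta> k leaves \<zeta> 0 and with it the exponential
    factor fixed.\<close>
  from DERIV_cmult[OF this, of "exp (- (p 0 * tail_sum n t 1 + \<zeta> 0))"] show ?thesis
    using k by (simp add: ker_def dker_def)
qed

text \<open>The exponential contributes the factor - \<open>p 0\<close>, and each phase with index
  in \<open>J\<close> moves at speed \<open>p k\<close>. Thus a time derivative is traded for
  parameter derivatives, the source of the operator in the formulas.\<close>

lemma DERIV_ker_time:
  "((\<lambda>x. ker (t(j := x)) \<zeta>) has_real_derivative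
    (- p 0 * ker t \<zeta> + (\<Sum>k\<in>J. p k * dker k t \<zeta>))) (at (t j))"
proof -
  have \<phi>: "((\<lambda>x. p k * \<sigma> k (t(j := x)) + \<zeta> k) has_real_derivative (if k \<in> J then p k else 0)) (at (t j))"
    if k: "k \<in> {1..K}" for k
  proof -
    obtain s where "\<And>x. \<sigma> k (t(j := x)) = s + (if k \<in> J then x else 0)"
      using \<sigma>_upd[OF k] by blast
    then show ?thesis by (auto intro!: derivative_eq_intros)
  qed
  have "((\<lambda>x. Q (phase (t(j := x)) \<zeta>)) has_real_derivative
      (\<Sum>k\<in>{1..K}. D k (phase t \<zeta>) * (if k \<in> J then p k else 0))) (at (t j))"
    using DERIV_Q[OF \<phi>] unfolding phase_def by simp
  also have "(\<Sum>k\<in>{1..K}. D k (phase t \<zeta>) * (if k \<in> J then p k else 0)) = (\<Sum>k\<in>J. p k * D k (phase t \<zeta>))"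
    using J by (intro sum.mono_neutral_cong_right) auto
  finally have Q': "((\<lambda>x. Q (phase (t(j := x)) \<zeta>)) has_real_derivative
      (\<Sum>k\<in>J. p k * D k (phase t \<zeta>))) (at (t j))" .
  obtain T where T: "\<And>x. tail_sum n (t(j := x)) 1 = T + x"
    using tail_sum_upd_1[OF j] by blast
  have Tj: "tail_sum n t 1 = T + t j" using T[of "t j"] by simp
  have "((\<lambda>x. exp (- (p 0 * tail_sum n (t(j := x)) 1 + \<zeta> 0))) has_real_derivative
      - p 0 * exp (- (p 0 * tail_sum n t 1 + \<zeta> 0))) (at (t j))"
    unfolding T Tj by (auto intro!: derivative_eq_intros)
  from DERIV_mult[OF this Q'] show ?thesis
    unfolding ker_def dker_def by (simp add: sum_distrib_left sum_distrib_right mult_ac)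
qed

text \<open>\<open>e\<close> stands for \<open>ker\<close> or some \<open>dker k\<close>, which obey
  the same bound; the growth of \<open>h\<close> and the decay of \<open>e\<close> combine to the
  negative exponent a - \<open>p 0\<close>.\<close>

lemma integrable_orthant_ker:
  assumes h: "(\<lambda>t. indicator (orthant n) t * h t) \<in> borel_measurable (lebesgue_on_coords {1..n})"
    and le: "\<And>t. t \<in> orthant n \<Longrightarrow> \<bar>h t\<bar> \<le> C * exp (a * tail_sum n t 1)" and a: "a < p 0"
    and e: "e \<in> borel_measurable borel"
      "\<And>t. \<bar>e t\<bar> \<le> B * exp (- \<zeta> 0) * exp (- p 0 * tail_sum n t 1)"
  shows "integrable (lebesgue_on_coords {1..n}) (\<lambda>t. indicator (orthant n) t * h t * e t)"
proof (rule integrable_orthant_bound)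
  show "(\<lambda>t. indicator (orthant n) t * h t * e t) \<in> borel_measurable (lebesgue_on_coords {1..n})"
    by (intro borel_measurable_times h borel_measurable_lebesgue_on_coords e)
  show "a - p 0 < 0" using a by simp
  show "\<bar>indicator (orthant n) t * h t * e t\<bar> \<le> C * B * exp (- \<zeta> 0) * exp ((a - p 0) * tail_sum n t 1)"
    if "t \<in> orthant n" for t
  proof -
    have "\<bar>indicator (orthant n) t * h t * e t\<bar> = \<bar>h t\<bar> * \<bar>e t\<bar>"
      using that by (simp add: abs_mult)
    also have "\<dots> \<le> (C * exp (a * tail_sum n t 1)) * (B * exp (- \<zeta> 0) * exp (- p 0 * tail_sum n t 1))"
      using le[OF that] e(2)[of t] by (intro mult_mono) auto
    also have "\<dots> = C * B * exp (- \<zeta> 0) * exp ((a - p 0) * tail_sum n t 1)"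
      by (rule exp_mult_collect)
    finally show ?thesis .
  qed
qed simp

lemma orthant_upd: "t \<in> orthant n \<Longrightarrow> 0 \<le> x \<Longrightarrow> t(j := x) \<in> orthant n"
  using j by (auto simp: orthant_def Rn_def PiE_iff extensional_def)

text \<open>The boundary term at infinity in the integration by parts: along the line the tail sum
  is T + x, so the majorant exp ((a - p 0) * (T + x)) tends to 0.\<close>

lemma mult_ker_tendsto_0:
  assumes le: "\<And>t. t \<in> orthant n \<Longrightarrow> \<bar>g t\<bar> \<le> C * exp (a * tail_sum n t 1)" and a: "a < p 0"
    and t: "t \<in> orthant n"
  shows "((\<lambda>x. g (t(j := x)) * ker (t(j := x)) \<zeta>) \<longlongrightarrow> 0) at_top"
proof -
  obtain T where T: "\<And>x. tail_sum n (t(j := x)) 1 = T + x"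
    using tail_sum_upd_1[OF j] by blast
  show ?thesis
  proof (rule Lim_null_comparison)
    show "\<forall>\<^sub>F x in at_top. norm (g (t(j := x)) * ker (t(j := x)) \<zeta>)
        \<le> C * B * exp (- \<zeta> 0) * exp ((a - p 0) * (T + x))"
      using eventually_ge_at_top[of "0 :: real"]
    proof eventually_elim
      fix x :: real assume "0 \<le> x"
      note le' = le[OF orthant_upd[OF t this]]
      have "norm (g (t(j := x)) * ker (t(j := x)) \<zeta>)
          \<le> (C * exp (a * tail_sum n (t(j := x)) 1)) * (B * exp (- \<zeta> 0) * exp (- p 0 * tail_sum n (t(j := x)) 1))"
        unfolding real_norm_def abs_mult using le' abs_ker_le[of "t(j := x)" \<zeta>] by (intro mult_mono) auto
      also have "\<dots> = C * B * exp (- \<zeta> 0) * exp ((a - p 0) * (T + x))"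
        unfolding T by (rule exp_mult_collect)
      finally show "norm (g (t(j := x)) * ker (t(j := x)) \<zeta>)
        \<le> C * B * exp (- \<zeta> 0) * exp ((a - p 0) * (T + x))" .
    qed
    have "filterlim (\<lambda>x. T + x) at_top at_top"
      by (intro filterlim_tendsto_add_at_top[OF tendsto_const] filterlim_ident)
    then have "filterlim (\<lambda>x. (a - p 0) * (T + x)) at_bot at_top"
      by (rule filterlim_tendsto_neg_mult_at_bot[OF tendsto_const, rotated]) (use a in auto)
    then have "((\<lambda>x. exp ((a - p 0) * (T + x))) \<longlongrightarrow> 0) at_top"
      by (rule filterlim_compose[OF exp_at_bot])
    then show "((\<lambda>x. C * B * exp (- \<zeta> 0) * exp ((a - p 0) * (T + x))) \<longlongrightarrow> 0) at_top"
      by (rule tendsto_mult_right_zero)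
  qed
qed

text \<open>\<open>g\<close> and \<open>g'\<close> model one coordinate of an original and of its
  partial derivative, each with its own growth exponent below \<open>p 0\<close>.\<close>

context
  fixes g g' :: "(nat \<Rightarrow> real) \<Rightarrow> real" and a a' C C' :: real
  assumes g: "(\<lambda>t. indicator (orthant n) t * g t) \<in> borel_measurable (lebesgue_on_coords {1..n})"
      "\<And>t. t \<in> orthant n \<Longrightarrow> \<bar>g t\<bar> \<le> C * exp (a * tail_sum n t 1)" "a < p 0"
    and g': "(\<lambda>t. indicator (orthant n) t * g' t) \<in> borel_measurable (lebesgue_on_coords {1..n})"
      "\<And>t. t \<in> orthant n \<Longrightarrow> \<bar>g' t\<bar> \<le> C' * exp (a' * tail_sum n t 1)" "a' < p 0"
    and deriv: "\<And>t. t \<in> orthant n \<Longrightarrow>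
      ((\<lambda>x. g (t(j := x))) has_real_derivative g' t) (at (t j) within {0..})"
begin

lemma integrable_ker: "integrable (lebesgue_on_coords {1..n}) (\<lambda>t. indicator (orthant n) t * g t * ker t \<zeta>)"
  by (rule integrable_orthant_ker[OF g ker_measurable abs_ker_le])

lemma integrable_ker': "integrable (lebesgue_on_coords {1..n}) (\<lambda>t. indicator (orthant n) t * g' t * ker t \<zeta>)"
  by (rule integrable_orthant_ker[OF g' ker_measurable abs_ker_le])

lemma integrable_dker:
  "k \<in> {1..K} \<Longrightarrow> integrable (lebesgue_on_coords {1..n}) (\<lambda>t. indicator (orthant n) t * g t * dker k t \<zeta>)"
  by (rule integrable_orthant_ker[OF g dker_measurable abs_dker_le])

lemma DERIV_integral_ker:
  assumes k: "k \<in> {1..K}"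
  shows "((\<lambda>x. LINT t|lebesgue_on_coords {1..n}. indicator (orthant n) t * g t * ker t (\<zeta>(k := x)))
    has_real_derivative (LINT t|lebesgue_on_coords {1..n}. indicator (orthant n) t * g t * dker k t \<zeta>))
    (at (\<zeta> k))"
proof -
  let ?M = "lebesgue_on_coords {1..n}"
  \<comment> \<open>The majorant depends on the parameters only through \<zeta> 0, hence is the same
    for every value of \<zeta> k with k \<ge> 1.\<close>
  let ?w = "\<lambda>t. \<bar>indicator (orthant n) t * g t * (B * exp (- \<zeta> 0) * exp (- p 0 * tail_sum n t 1))\<bar>"
  have "((\<lambda>x. LINT t|?M. indicator (orthant n) t * g t * ker t (\<zeta>(k := x))) has_real_derivative
      (LINT t|?M. indicator (orthant n) t * g t * dker k t (\<zeta>(k := \<zeta> k)))) (at (\<zeta> k))"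
  proof (rule DERIV_lebesgue_integral)
    show "integrable ?M (\<lambda>t. indicator (orthant n) t * g t * ker t (\<zeta>(k := x)))" for x
      by (rule integrable_ker)
    show "((\<lambda>y. indicator (orthant n) t * g t * ker t (\<zeta>(k := y))) has_real_derivative
        indicator (orthant n) t * g t * dker k t (\<zeta>(k := x))) (at x)" for x t
      by (rule DERIV_cmult[OF DERIV_ker_shift[OF k]])
    show "(\<lambda>t. indicator (orthant n) t * g t * dker k t (\<zeta>(k := \<zeta> k))) \<in> borel_measurable ?M"
      using integrable_dker[OF k] by (rule borel_measurable_integrable)
    have "0 \<le> B * exp (- \<zeta> 0) * exp (- p 0 * tail_sum n t 1)" for t
      using order_trans[OF abs_ge_zero abs_ker_le] .
    then show "integrable ?M ?w"
      by (intro integrable_abs integrable_orthant_ker[OF g]) auto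
    show "\<bar>indicator (orthant n) t * g t * dker k t (\<zeta>(k := x))\<bar> \<le> ?w t" for x t
      using abs_dker_le[OF k, of t "\<zeta>(k := x)"] k unfolding abs_mult[of "_ * g t"]
      by (intro mult_left_mono) auto
  qed
  then show ?thesis by simp
qed

text \<open>The integral of the \<open>j\<close>-th derivative of \<open>g\<close> times
  \<open>ker\<close> reduces to the face term with a minus sign. Splitting that derivative by the
  product rule and \<open>DERIV_ker_time\<close>, and moving the kernel terms to the other side,
  gives the signs of \<open>p 0\<close> and of the sum over \<open>J\<close>.\<close>

lemma
  shows integrable_face_ker: "integrable (lebesgue_on_coords ({1..n} - {j}))
      (\<lambda>t. indicator (orthant n) (t(j := 0)) * g (t(j := 0)) * ker (t(j := 0)) \<zeta>)"
    and integral_by_parts_ker: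
      "(LINT t|lebesgue_on_coords {1..n}. indicator (orthant n) t * g' t * ker t \<zeta>)
        = - (LINT t|lebesgue_on_coords ({1..n} - {j}).
              indicator (orthant n) (t(j := 0)) * g (t(j := 0)) * ker (t(j := 0)) \<zeta>)
          + (p 0 * (LINT t|lebesgue_on_coords {1..n}. indicator (orthant n) t * g t * ker t \<zeta>)
             - (\<Sum>k\<in>J. p k * (LINT t|lebesgue_on_coords {1..n}. indicator (orthant n) t * g t * dker k t \<zeta>)))"
proof -
  let ?M = "lebesgue_on_coords {1..n}" and ?i = "indicator (orthant n) :: _ \<Rightarrow> real"
  let ?G = "\<lambda>t. g t * ker t \<zeta>"
  let ?G' = "\<lambda>t. g' t * ker t \<zeta> + g t * (- p 0 * ker t \<zeta> + (\<Sum>k\<in>J. p k * dker k t \<zeta>))"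
  have eq: "?i t * ?G' t = ?i t * g' t * ker t \<zeta> + ((- p 0) * (?i t * g t * ker t \<zeta>)
      + (\<Sum>k\<in>J. p k * (?i t * g t * dker k t \<zeta>)))" for t
    by (simp add: algebra_simps sum_distrib_left)
  have dker_int: "integrable ?M (\<lambda>t. ?i t * g t * dker k t \<zeta>)" if "k \<in> J" for k
    using that J by (intro integrable_dker) blast
  have ints: "integrable ?M (\<lambda>t. (- p 0) * (?i t * g t * ker t \<zeta>))"
    "integrable ?M (\<lambda>t. \<Sum>k\<in>J. p k * (?i t * g t * dker k t \<zeta>))"
    by (intro integrable_mult_right integrable_ker)
       (intro Bochner_Integration.integrable_sum integrable_mult_right dker_int)
  have int: "integrable ?M (\<lambda>t. ?i t * ?G' t)"
    unfolding eq by (intro Bochner_Integration.integrable_add integrable_ker' ints)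
  have der: "((\<lambda>x. ?G (t(j := x))) has_real_derivative ?G' t) (at (t j) within {0..})"
    if "t \<in> orthant n" for t
    using DERIV_mult[OF deriv[OF that] has_field_derivative_at_within[OF DERIV_ker_time[of t \<zeta>]]]
    by (simp add: algebra_simps)
  note parts = integral_partial_derivative_orthant[where G = ?G and G' = ?G', OF j int der mult_ker_tendsto_0[OF g(2,3)]]
  show "integrable (lebesgue_on_coords ({1..n} - {j})) (\<lambda>t. ?i (t(j := 0)) * g (t(j := 0)) * ker (t(j := 0)) \<zeta>)"
    using parts(1) by (simp add: mult.assoc)
  have "(LINT t|?M. ?i t * ?G' t) = (LINT t|?M. ?i t * g' t * ker t \<zeta>)
      + ((LINT t|?M. (- p 0) * (?i t * g t * ker t \<zeta>)) + (LINT t|?M. (\<Sum>k\<in>J. p k * (?i t * g t * dker k t \<zeta>))))"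
    unfolding eq using ints integrable_ker'
    by (simp only: Bochner_Integration.integral_add Bochner_Integration.integrable_add)
  also have "(LINT t|?M. (\<Sum>k\<in>J. p k * (?i t * g t * dker k t \<zeta>)))
      = (\<Sum>k\<in>J. p k * (LINT t|?M. ?i t * g t * dker k t \<zeta>))"
    by (subst Bochner_Integration.integral_sum)
       (simp_all only: integrable_mult_right dker_int integral_mult_right_zero)
  also have "(LINT t|?M. (- p 0) * (?i t * g t * ker t \<zeta>)) = (- p 0) * (LINT t|?M. ?i t * g t * ker t \<zeta>)"
    by (rule integral_mult_right_zero)
  finally show "(LINT t|?M. ?i t * g' t * ker t \<zeta>)
        = - (LINT t|lebesgue_on_coords ({1..n} - {j}). ?i (t(j := 0)) * g (t(j := 0)) * ker (t(j := 0)) \<zeta>)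
          + (p 0 * (LINT t|?M. ?i t * g t * ker t \<zeta>) - (\<Sum>k\<in>J. p k * (LINT t|?M. ?i t * g t * dker k t \<zeta>)))"
    using parts(2) by (simp add: mult.assoc)
qed

end

end

section \<open>Transforms of originals with values in the algebra\<close>

lemma cut_off_nth: "cut_off U f t i = indicator U t * f t i"
  by (simp add: cut_off_def cd_zero_def)

text \<open>Projection to a coordinate preserves almost everywhere continuity, which gives
  measurability; the growth condition passes to coordinates because each is bounded by the
  norm.\<close>

lemma original_on_orthantD:
  assumes f: "original_on_orthant r n f a" and i: "i < 2 ^ r"
  shows "(\<lambda>t. indicator (orthant n) t * f t i) \<in> borel_measurable (lebesgue_on_coords {1..n})"
    and "\<exists>C. \<forall>t\<in>orthant n. \<bar>f t i\<bar> \<le> C * exp (a * tail_sum n t 1)"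
proof -
  obtain b where orig: "original r n (cut_off (orthant n) f) a b"
    using f unfolding original_on_orthant_def ..
  have "continuous_on UNIV (\<lambda>z::cd. z i)"
    by (rule continuous_on_product_coordinates)
  then have proj: "isCont (\<lambda>z::cd. z i) z" for z
    by (rule continuous_on_interior) simp
  have "AE t in lebesgue_on_coords {1..n}. continuous (at t within Rn n) (cut_off (orthant n) f)"
    using orig unfolding original_def by blast
  then have "AE t in lebesgue_on_coords {1..n}.
      continuous (at t within Rn n) (\<lambda>t. indicator (orthant n) t * f t i)"
  proof eventually_elim
    fix t assume "continuous (at t within Rn n) (cut_off (orthant n) f)"
    then have "continuous (at t within Rn n) (\<lambda>t. cut_off (orthant n) f t i)"
      unfolding continuous_within by (rule isCont_tendsto_compose[OF proj])
    then show "continuous (at t within Rn n) (\<lambda>t. indicator (orthant n) t * f t i)"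
      by (simp add: cut_off_nth)
  qed
  then show "(\<lambda>t. indicator (orthant n) t * f t i) \<in> borel_measurable (lebesgue_on_coords {1..n})"
    by (rule AE_continuous_imp_measurable)
  have "\<forall>v\<in>{1..n} \<rightarrow> {-1, 1::real}. \<exists>C>0. \<forall>t\<in>Rn n. (\<forall>k\<in>{1..n}. 0 \<le> v k * t k) \<longrightarrow>
      cd_norm r (cut_off (orthant n) f t) < C * exp (\<Sum>k\<in>{1..n}. (if v k = 1 then a else b) * t k)"
    using orig unfolding original_def by blast
  \<comment> \<open>The sign vector with all entries 1 selects the orthant itself, so only the
    exponent \<open>a\<close> remains.\<close>
  then obtain C where C: "\<forall>t\<in>Rn n. (\<forall>k\<in>{1..n}. 0 \<le> 1 * t k) \<longrightarrow>
      cd_norm r (cut_off (orthant n) f t) < C * exp (\<Sum>k\<in>{1..n}. (if (1::real) = 1 then a else b) * t k)"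
    by (drule_tac x = "\<lambda>_. 1" in bspec) auto
  have "\<bar>f t i\<bar> \<le> C * exp (a * tail_sum n t 1)" if t: "t \<in> orthant n" for t
  proof -
    have "\<bar>f t i\<bar> \<le> cd_norm r (cut_off (orthant n) f t)"
      using abs_nth_le_cd_norm[OF i, of "cut_off (orthant n) f t"] t by (simp add: cut_off_def)
    also have "\<dots> < C * exp (a * tail_sum n t 1)"
      using C t by (simp add: orthant_def tail_sum_def sum_distrib_left)
    finally show ?thesis by simp
  qed
  then show "\<exists>C. \<forall>t\<in>orthant n. \<bar>f t i\<bar> \<le> C * exp (a * tail_sum n t 1)" by blast
qed

lemma partial_deriv_has_real_derivative:
  assumes "partial_differentiable_on_orthant n f k" "t \<in> orthant n"
  shows "((\<lambda>x. f (t(k := x)) i) has_real_derivative partial_deriv f k t i) (at (t k) within {0..})"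
  using assms unfolding partial_differentiable_on_orthant_def partial_deriv_def
    has_real_derivative_iff_has_vector_derivative
  by (blast intro: vector_derivative_works[THEN iffD1])

text \<open>Carries the scalar formula through the structure constants of the product:
  \<open>X\<close> are face terms, \<open>Y\<close> transforms and \<open>Z\<close> parameter
  derivatives.\<close>

lemma sum_sum_collect:
  fixes c X Y :: "'a \<Rightarrow> 'b \<Rightarrow> real" and Z :: "'a \<Rightarrow> 'b \<Rightarrow> 'c \<Rightarrow> real"
  shows "(\<Sum>a\<in>A. \<Sum>b\<in>B. c a b * (- X a b + (q * Y a b - (\<Sum>k\<in>J. p k * Z a b k))))
    = - (\<Sum>a\<in>A. \<Sum>b\<in>B. c a b * X a b) + (q * (\<Sum>a\<in>A. \<Sum>b\<in>B. c a b * Y a b)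
      + - (\<Sum>k\<in>J. p k * (\<Sum>a\<in>A. \<Sum>b\<in>B. c a b * Z a b k)))"
proof -
  have "(\<Sum>k\<in>J. p k * (\<Sum>a\<in>A. \<Sum>b\<in>B. c a b * Z a b k))
      = (\<Sum>k\<in>J. \<Sum>a\<in>A. \<Sum>b\<in>B. c a b * (p k * Z a b k))"
    by (simp add: sum_distrib_left mult.left_commute)
  also have "\<dots> = (\<Sum>a\<in>A. \<Sum>b\<in>B. \<Sum>k\<in>J. c a b * (p k * Z a b k))"
    by (subst sum.swap, rule sum.cong[OF refl], rule sum.swap)
  also have "\<dots> = (\<Sum>a\<in>A. \<Sum>b\<in>B. c a b * (\<Sum>k\<in>J. p k * Z a b k))"
    by (simp add: sum_distrib_left)
  finally show ?thesis
    by (simp add: distrib_left right_diff_distrib sum.distrib sum_subtractf sum_negf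
        sum_distrib_left mult.left_commute)
qed

lemma
  fixes c :: "'a \<Rightarrow> 'b \<Rightarrow> real" and h :: "'a \<Rightarrow> 'b \<Rightarrow> 'c \<Rightarrow> real"
  assumes h: "\<And>a b. a \<in> A \<Longrightarrow> b \<in> B \<Longrightarrow> integrable M (h a b)"
  shows integrable_double_sum: "integrable M (\<lambda>t. \<Sum>a\<in>A. \<Sum>b\<in>B. c a b * h a b t)"
    and integral_double_sum: "(LINT t|M. (\<Sum>a\<in>A. \<Sum>b\<in>B. c a b * h a b t))
      = (\<Sum>a\<in>A. \<Sum>b\<in>B. c a b * (LINT t|M. h a b t))"
proof -
  have 1: "integrable M (\<lambda>t. \<Sum>b\<in>B. c a b * h a b t)" if "a \<in> A" for a
    by (intro Bochner_Integration.integrable_sum integrable_mult_right h that)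
  then show "integrable M (\<lambda>t. \<Sum>a\<in>A. \<Sum>b\<in>B. c a b * h a b t)"
    by (rule Bochner_Integration.integrable_sum)
  have "(LINT t|M. (\<Sum>a\<in>A. \<Sum>b\<in>B. c a b * h a b t)) = (\<Sum>a\<in>A. LINT t|M. (\<Sum>b\<in>B. c a b * h a b t))"
    by (rule Bochner_Integration.integral_sum[OF 1])
  also have "\<dots> = (\<Sum>a\<in>A. \<Sum>b\<in>B. c a b * (LINT t|M. h a b t))"
    by (intro sum.cong refl) (simp add: Bochner_Integration.integral_sum h)
  finally show "(LINT t|M. (\<Sum>a\<in>A. \<Sum>b\<in>B. c a b * h a b t))
      = (\<Sum>a\<in>A. \<Sum>b\<in>B. c a b * (LINT t|M. h a b t))" .
qed

text \<open>A coordinate of the integrand is a combination, with the structure constants as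
  coefficients, of products of a coordinate of the function with a coordinate of exp (-u). The
  scalar results apply to every such pair, and finite linear combination restores the algebra-valued
  statement.\<close>

lemma transform_partial_deriv:
  fixes r n j K :: nat and J :: "nat set" and Q :: "nat \<Rightarrow> cd \<Rightarrow> real" and u :: kernel
    and f :: "(nat \<Rightarrow> real) \<Rightarrow> cd" and p \<zeta> :: cd
  defines "F \<equiv> transform r n (cut_off (orthant n) f) u p"
  assumes j: "j \<in> {1..n}" and J: "J \<subseteq> {1..K}"
    and \<sigma>: "\<And>k. \<sigma> k \<in> borel_measurable borel"
      "\<And>k t x. k \<in> {1..K} \<Longrightarrow> \<sigma> k (t(j := x)) = \<sigma> k (t(j := 0)) + (if k \<in> J then x else 0)"
    and Q: "\<And>b. b < 2 ^ r \<Longrightarrow> \<exists>D B. bounded_C1 {1..K} (Q b) D B"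
    and u: "\<And>b t \<zeta>. b < 2 ^ r \<Longrightarrow> cd_exp r (\<lambda>i. - u p t \<zeta> i) b
      = exp (- (p 0 * tail_sum n t 1 + \<zeta> 0)) * Q b (\<lambda>k. p k * \<sigma> k t + \<zeta> k)"
    and f: "original_on_orthant r n f a\<^sub>f" "a\<^sub>f < p 0"
    and f': "original_on_orthant r n (partial_deriv f j) a'" "a' < p 0"
    and diff: "partial_differentiable_on_orthant n f j"
  shows "transform_exists r n (cut_off (orthant n) (partial_deriv f j)) u p \<zeta>" (is ?ex')
    and "face_transform_exists r n j (cut_off (orthant n) f) u p \<zeta>" (is ?face)
    and "transform_exists r n (cut_off (orthant n) f) u p \<zeta>" (is ?ex)
    and "k \<in> J \<Longrightarrow> shift_exists k F \<zeta>"
    and "transform r n (cut_off (orthant n) (partial_deriv f j)) u p \<zeta> =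
      (\<lambda>i. - face_transform r n j (cut_off (orthant n) f) u p \<zeta> i
           + (p 0 * F \<zeta> i + (\<Sum>k\<in>J. p k * shift_op k F \<zeta> i)))" (is ?formula)
proof -
  let ?N = "2 ^ r :: nat" and ?M = "lebesgue_on_coords {1..n}" and ?MI = "lebesgue_on_coords ({1..n} - {j})"
  let ?i = "indicator (orthant n) :: (nat \<Rightarrow> real) \<Rightarrow> real" and ?f' = "partial_deriv f j"
  obtain c where c: "\<And>x y i. cd_mult r x y i = (\<Sum>a<?N. \<Sum>b<?N. c i a b * x a * y b)"
    using cd_mult_structure_constants[of r] by blast
  obtain D where "\<forall>b. b < ?N \<longrightarrow> (\<exists>B. bounded_C1 {1..K} (Q b) (D b) B)"
    using choice[of "\<lambda>b D. b < ?N \<longrightarrow> (\<exists>B. bounded_C1 {1..K} (Q b) D B)"] Q by blast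
  then obtain B where B: "\<And>b. b < ?N \<Longrightarrow> bounded_C1 {1..K} (Q b) (D b) (B b)"
    using choice[of "\<lambda>b B. b < ?N \<longrightarrow> bounded_C1 {1..K} (Q b) (D b) B"] by blast
  \<comment> \<open>Each coordinate \<open>b\<close> of the exponential is its own instance of the
    scalar model, with common \<sigma> and \<open>J\<close> but its own \<open>Q\<close>,
    \<open>D\<close> and \<open>B\<close>.\<close>
  have loc: "orthant_kernel n j K J \<sigma> (Q b) (D b) (B b)" if "b < ?N" for b
    by (rule orthant_kernel.intro[OF j J \<sigma> B[OF that]])
  define E where "E b = orthant_kernel.ker n \<sigma> p (Q b)" for b
  define dE where "dE b = orthant_kernel.dker n \<sigma> p (D b)" for b
  have E: "cd_exp r (\<lambda>i. - u p t \<zeta> i) b = E b t \<zeta>" if "b < ?N" for b t \<zeta>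
    using u[OF that] orthant_kernel.ker_def[OF loc[OF that]] orthant_kernel.phase_def[OF loc[OF that]]
    unfolding E_def by simp
  have integrand: "integrand r (cut_off (orthant n) h) u p \<zeta> t i
      = (\<Sum>a<?N. \<Sum>b<?N. c i a b * (?i t * h t a * E b t \<zeta>))" for h \<zeta> t i
    unfolding integrand_def c by (intro sum.cong) (auto simp: E cut_off_nth)
  have components: "integrable ?M (\<lambda>t. ?i t * f t a * E b t \<zeta>)"
    "integrable ?M (\<lambda>t. ?i t * ?f' t a * E b t \<zeta>)"
    "integrable ?MI (\<lambda>t. ?i (t(j := 0)) * f (t(j := 0)) a * E b (t(j := 0)) \<zeta>)"
    "\<And>k. k \<in> {1..K} \<Longrightarrow> ((\<lambda>x. LINT t|?M. ?i t * f t a * E b t (\<zeta>(k := x))) has_real_derivative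
        (LINT t|?M. ?i t * f t a * dE b k t \<zeta>)) (at (\<zeta> k))"
    "(LINT t|?M. ?i t * ?f' t a * E b t \<zeta>)
        = - (LINT t|?MI. ?i (t(j := 0)) * f (t(j := 0)) a * E b (t(j := 0)) \<zeta>)
          + (p 0 * (LINT t|?M. ?i t * f t a * E b t \<zeta>)
             - (\<Sum>k\<in>J. p k * (LINT t|?M. ?i t * f t a * dE b k t \<zeta>)))"
    if ab: "a < ?N" "b < ?N" for a b \<zeta>
  proof -
    obtain C where C: "\<And>t. t \<in> orthant n \<Longrightarrow> \<bar>f t a\<bar> \<le> C * exp (a\<^sub>f * tail_sum n t 1)"
      using original_on_orthantD(2)[OF f(1) ab(1)] by blast
    obtain C' where C': "\<And>t. t \<in> orthant n \<Longrightarrow> \<bar>?f' t a\<bar> \<le> C' * exp (a' * tail_sum n t 1)"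
      using original_on_orthantD(2)[OF f'(1) ab(1)] by blast
    note hyps = loc[OF ab(2)] original_on_orthantD(1)[OF f(1) ab(1)] C f(2)
      original_on_orthantD(1)[OF f'(1) ab(1)] C' f'(2) partial_deriv_has_real_derivative[OF diff, of _ a]
    show "integrable ?M (\<lambda>t. ?i t * f t a * E b t \<zeta>)"
      unfolding E_def by (rule orthant_kernel.integrable_ker[where p = p, OF hyps])
    show "integrable ?M (\<lambda>t. ?i t * ?f' t a * E b t \<zeta>)"
      unfolding E_def by (rule orthant_kernel.integrable_ker'[where p = p, OF hyps])
    show "integrable ?MI (\<lambda>t. ?i (t(j := 0)) * f (t(j := 0)) a * E b (t(j := 0)) \<zeta>)"
      unfolding E_def by (rule orthant_kernel.integrable_face_ker[where p = p, OF hyps])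
    show "((\<lambda>x. LINT t|?M. ?i t * f t a * E b t (\<zeta>(k := x))) has_real_derivative
        (LINT t|?M. ?i t * f t a * dE b k t \<zeta>)) (at (\<zeta> k))" if "k \<in> {1..K}" for k
      unfolding E_def dE_def by (rule orthant_kernel.DERIV_integral_ker[where p = p, OF hyps that])
    show "(LINT t|?M. ?i t * ?f' t a * E b t \<zeta>)
        = - (LINT t|?MI. ?i (t(j := 0)) * f (t(j := 0)) a * E b (t(j := 0)) \<zeta>)
          + (p 0 * (LINT t|?M. ?i t * f t a * E b t \<zeta>)
             - (\<Sum>k\<in>J. p k * (LINT t|?M. ?i t * f t a * dE b k t \<zeta>)))"
      unfolding E_def dE_def by (rule orthant_kernel.integral_by_parts_ker[where p = p, OF hyps])
  qed
  show ?ex unfolding transform_exists_def integrand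
    by (intro allI integrable_double_sum components(1)) auto
  show ?ex' unfolding transform_exists_def integrand
    by (intro allI integrable_double_sum components(2)) auto
  show ?face unfolding face_transform_exists_def integrand
    by (intro allI integrable_double_sum components(3)) auto
  have F: "F \<zeta> i = (\<Sum>a<?N. \<Sum>b<?N. c i a b * (LINT t|?M. ?i t * f t a * E b t \<zeta>))" for \<zeta> i
    unfolding F_def transform_def integrand
    by (intro integral_double_sum components(1)) auto
  have F': "transform r n (cut_off (orthant n) ?f') u p \<zeta> i
      = (\<Sum>a<?N. \<Sum>b<?N. c i a b * (LINT t|?M. ?i t * ?f' t a * E b t \<zeta>))" for \<zeta> i
    unfolding transform_def integrand
    by (intro integral_double_sum components(2)) auto
  have face: "face_transform r n j (cut_off (orthant n) f) u p \<zeta> i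
      = (\<Sum>a<?N. \<Sum>b<?N. c i a b * (LINT t|?MI. ?i (t(j := 0)) * f (t(j := 0)) a * E b (t(j := 0)) \<zeta>))" for \<zeta> i
    unfolding face_transform_def integrand
    by (intro integral_double_sum components(3)) auto
  have dF: "((\<lambda>x. F (\<zeta>(k := x)) i) has_real_derivative
      (\<Sum>a<?N. \<Sum>b<?N. c i a b * (LINT t|?M. ?i t * f t a * dE b k t \<zeta>))) (at (\<zeta> k))"
    if "k \<in> J" for k i
  proof -
    have "k \<in> {1..K}" using that J by blast
    then show ?thesis
      unfolding F by (intro DERIV_sum DERIV_cmult components(4)) (auto simp del: One_nat_def)
  qed
  show "shift_exists k F \<zeta>" if "k \<in> J"
    unfolding shift_exists_def using dF[OF that] by (auto simp: real_differentiable_def)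
  show ?formula
  proof
    fix i
    let ?X = "\<lambda>a b. LINT t|?MI. ?i (t(j := 0)) * f (t(j := 0)) a * E b (t(j := 0)) \<zeta>"
    let ?Y = "\<lambda>a b. LINT t|?M. ?i t * f t a * E b t \<zeta>"
    let ?Z = "\<lambda>a b k. LINT t|?M. ?i t * f t a * dE b k t \<zeta>"
    \<comment> \<open>\<open>shift_op\<close> is minus the \<zeta> derivative, which absorbs the
      minus sign in front of the sum over \<open>J\<close> in the scalar formula.\<close>
    have S: "(\<Sum>k\<in>J. p k * shift_op k F \<zeta> i) = - (\<Sum>k\<in>J. p k * (\<Sum>a<?N. \<Sum>b<?N. c i a b * ?Z a b k))"
      unfolding sum_negf[symmetric]
    proof (rule sum.cong)
      fix k assume k: "k \<in> J"
      show "p k * shift_op k F \<zeta> i = - (p k * (\<Sum>a<?N. \<Sum>b<?N. c i a b * ?Z a b k))"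
        unfolding shift_op_def DERIV_imp_deriv[OF dF[OF k]] by simp
    qed simp
    have "transform r n (cut_off (orthant n) ?f') u p \<zeta> i
        = (\<Sum>a<?N. \<Sum>b<?N. c i a b * (- ?X a b + (p 0 * ?Y a b - (\<Sum>k\<in>J. p k * ?Z a b k))))"
      unfolding F' by (intro sum.cong refl arg_cong[where f = "(*) _"] components(5)) auto
    also have "\<dots> = - (\<Sum>a<?N. \<Sum>b<?N. c i a b * ?X a b) + (p 0 * (\<Sum>a<?N. \<Sum>b<?N. c i a b * ?Y a b)
        + - (\<Sum>k\<in>J. p k * (\<Sum>a<?N. \<Sum>b<?N. c i a b * ?Z a b k)))"
      by (rule sum_sum_collect)
    finally show "transform r n (cut_off (orthant n) ?f') u p \<zeta> i
        = - face_transform r n j (cut_off (orthant n) f) u p \<zeta> i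
          + (p 0 * F \<zeta> i + (\<Sum>k\<in>J. p k * shift_op k F \<zeta> i))"
      unfolding S face F .
  qed
qed

text \<open>Integrability and differentiability are asserted alongside the identities because
  \<open>LINT\<close> and \<open>deriv\<close> are total: an equation between them would not by
  itself say that the integrals converge or the derivatives exist.\<close>

theorem theorem12:
  fixes r n j :: nat and f :: "(nat \<Rightarrow> real) \<Rightarrow> cd" and a1_f a1_df :: real and p \<zeta> :: cd
  assumes "2 \<le> r" and "2 ^ (r - 1) \<le> n" and "n \<le> 2 ^ r - 1" and "1 \<le> j" and "j \<le> n"
    and "original_on_orthant r n f a1_f"
    and "\<And>k. k \<in> {j - 1, j} \<Longrightarrow> 1 \<le> k \<Longrightarrow>
           partial_differentiable_on_orthant n f k \<and>
           (\<exists>b. original_on_orthant r n (partial_deriv f k) b)"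
    and "original_on_orthant r n (partial_deriv f j) a1_df"
    and "p \<in> parameters r n" and "max a1_f a1_df < cd_Re r p"
    and "\<zeta> \<in> parameters r n"
  shows
    "(\<forall>u \<in> {spherical_kernel r n, cartesian_kernel n}.
        transform_exists r n (cut_off (orthant n) (partial_deriv f j)) u p \<zeta> \<and>
        face_transform_exists r n j (cut_off (orthant n) f) u p \<zeta> \<and>
        transform_exists r n (cut_off (orthant n) f) u p \<zeta>) \<and>
     (let u = spherical_kernel r n; F = transform r n (cut_off (orthant n) f) u p in
        (\<forall>k\<in>{1..j}. shift_exists k F \<zeta>) \<and>
        transform r n (cut_off (orthant n) (partial_deriv f j)) u p \<zeta> =
          (\<lambda>i. - face_transform r n j (cut_off (orthant n) f) u p \<zeta> i
               + (p 0 * F \<zeta> i + (\<Sum>k=1..j. p k * shift_op k F \<zeta> i)))) \<and>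
     (let u = cartesian_kernel n; F = transform r n (cut_off (orthant n) f) u p in
        shift_exists j F \<zeta> \<and>
        transform r n (cut_off (orthant n) (partial_deriv f j)) u p \<zeta> =
          (\<lambda>i. - face_transform r n j (cut_off (orthant n) f) u p \<zeta> i
               + (p 0 * F \<zeta> i + p j * shift_op j F \<zeta> i)))"
proof -
  let ?K = "2 ^ r - 1 :: nat"
  have j: "j \<in> {1..n}" and r: "1 \<le> r" and K: "n \<le> ?K" and K1: "1 \<le> ?K"
    using assms(1,3-5) by auto
  have a: "a1_f < p 0" "a1_df < p 0"
    using assms(10) by (auto simp: cd_Re_eq)
  have diff: "partial_differentiable_on_orthant n f j"
    using assms(7)[of j] assms(4) by simp
  note f = assms(6) a(1) assms(8) a(2) diff
  let ?Q = "\<lambda>b \<theta>. if b = 0 then cos (\<theta> 1) else - (sin (\<theta> 1) * spherical_unit ?K b \<theta>)"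
  have \<sigma>: "(\<lambda>t. tail_sum n t k) \<in> borel_measurable borel" for k
    by (rule tail_sum_measurable)
  \<comment> \<open>For k \<ge> 1 the condition k \<le> j of \<open>tail_sum_upd\<close> is
    membership in \<open>{1..j}\<close>.\<close>
  have \<sigma>_upd: "tail_sum n (t(j := x)) k = tail_sum n (t(j := 0)) k + (if k \<in> {1..j} then x else 0)"
    if "k \<in> {1..?K}" for k t x
    by (subst tail_sum_upd[OF j]) (use that in simp)
  have Q: "\<exists>D B. bounded_C1 {1..?K} (?Q b) D B" if "b < 2 ^ r" for b
    by (rule bounded_C1_spherical[OF K1]) (use that in auto)
  have J: "{1..j} \<subseteq> {1..?K}" using j K by auto
  note spherical = transform_partial_deriv[where u = "spherical_kernel r n" and \<sigma> = "\<lambda>k t. tail_sum n t k"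
        and Q = ?Q and p = p and \<zeta> = \<zeta>,
      OF j J \<sigma> \<sigma>_upd Q cd_exp_spherical_kernel[OF r] f]
  \<comment> \<open>Points of \<open>Rn n\<close> have the value \<open>undefined\<close> outside
    \<open>{1..n}\<close>; setting \<tau> to 0 there realises the convention for indices beyond
    \<open>n\<close>.\<close>
  let ?\<tau> = "\<lambda>k t. if k \<in> {1..n} then t k else (0 :: real)"
  let ?\<rho> = "\<lambda>\<theta>::cd. sqrt (\<Sum>a\<in>{1..?K}. (\<theta> a)\<^sup>2)"
  let ?Q' = "\<lambda>b \<theta>. if b = 0 then cos (?\<rho> \<theta>) else - (sin (?\<rho> \<theta>) / ?\<rho> \<theta> * \<theta> b)"
  have \<tau>: "?\<tau> k \<in> borel_measurable borel" for k
    by (cases "k \<in> {1..n}") auto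
  have \<tau>_upd: "?\<tau> k (t(j := x)) = ?\<tau> k (t(j := 0)) + (if k \<in> {j} then x else 0)" for k t x
    using j by auto
  have Q': "\<exists>D B. bounded_C1 {1..?K} (?Q' b) D B" if "b < 2 ^ r" for b
    by (rule bounded_C1_cartesian) (use that in auto)
  have J': "{j} \<subseteq> {1..?K}" using j K by auto
  \<comment> \<open>The exponential was computed with the half-open range, whereas the scalar model
    uses the closed one.\<close>
  have "{1..<2 ^ r} = {1..?K}" by auto
  then have u': "cd_exp r (\<lambda>i. - cartesian_kernel n p t \<zeta> i) b = exp (- (p 0 * tail_sum n t 1 + \<zeta> 0))
      * ?Q' b (\<lambda>k. p k * ?\<tau> k t + \<zeta> k)" if "b < 2 ^ r" for b t \<zeta>
    using cd_exp_cartesian_kernel[OF that, of n p t \<zeta>] by simp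
  note cartesian = transform_partial_deriv[where u = "cartesian_kernel n" and \<sigma> = ?\<tau>
        and Q = ?Q' and p = p and \<zeta> = \<zeta>,
      OF j J' \<tau> \<tau>_upd Q' u' f]
  show ?thesis
    unfolding Let_def
    using spherical cartesian by auto
qed

end
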